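(* Let $B$ be a bipartite Bell operator in the two-input, two-output scenario with quantum bound $\eta^{\mathrm Q}$, and let $(|\psi\rangle,\{A_x\}_x,\{B_y\}_y)$ be a two-qubit target strategy on $\mathcal H_{Q_A}\otimes\mathcal H_{Q_B}=\mathbb C^2\otimes\mathbb C^2$. Suppose that for every two-qubit strategy $(\tilde\rho^{\mathsf q}_{Q_AQ_B},\{\tilde A^{\mathsf q}_x\}_x,\{\tilde B^{\mathsf q}_y\}_y)$ achieving $\langle B\rangle=\eta^{\mathrm Q}$ there exist unitaries $U_A$ on $\mathcal H_{Q_A}$ and $U_B$ on $\mathcal H_{Q_B}$ such that $$(U_A\otimes U_B)\tilde\rho^{\mathsf q}_{Q_AQ_B}(U_A^\dagger\otimes U_B^\dagger)=|\psi\rangle\langle\psi|,\qquad U_A\tilde A^{\mathsf q}_xU_A^\dagger=A_x,\qquad U_B\tilde B^{\mathsf q}_yU_B^\dagger=B_y\quad\text{for all }x,y.$$ Then, for every quantum strategy $(\rho_{\tilde Q_A\tilde Q_B},\{\tilde A_x\}_x,\{\tilde B_y\}_y)$ achieving $\langle B\rangle=\eta^{\mathrm Q}$, there exist unitaries $V_A$ on $\mathcal H_{\tilde Q_A}$ and $V_B$ on $\mathcal H_{\tilde Q_B}$ such that for any purification $|\Psi\rangle_{E\tilde Q_A\tilde Q_B}$ of $\rho_{\tilde Q_A\tilde Q_B}$ there is a state $|\xi\rangle_{\mathrm{Junk}}\in\mathcal H_{\mathrm{Junk}}$ with $$(\mathbb I_E\otimes V_A\otimes V_B)(\mathbb I_E\otimes\tilde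 A_x\otimes\tilde B_y)|\Psi\rangle_{E\tilde Q_A\tilde Q_B}=|\xi\rangle_{\mathrm{Junk}}\otimes(A_x\otimes B_y)|\psi\rangle_{Q_AQ_B}\quad\text{for all }x,y .$$
   Context: Two-input, two-output scenario: $x,y\in\{0,1\}$, binary outcomes. A quantum strategy is a state $\rho_{\tilde Q_A\tilde Q_B}$ on $\mathcal H_{\tilde Q_A}\otimes\mathcal H_{\tilde Q_B}$ with observables $\tilde A_x$ on $\mathcal H_{\tilde Q_A}$ and $\tilde B_y$ on $\mathcal H_{\tilde Q_B}$ that are Hermitian with square $\mathbb I$ (differences of the two projectors of projective measurements). A two-qubit strategy is one with both local spaces equal to $\mathbb C^2$. A Bell operator $B$ is a fixed real linear combination of $\mathbb I$, $\tilde A_x\otimes\mathbb I$, $\mathbb I\otimes\tilde B_y$, $\tilde A_x\otimes\tilde B_y$ (the same coefficients for every strategy); $\langle B\rangle=\mathrm{Tr}[\rho B]$, and its quantum bound $\eta^{\mathrm Q}$ is the maximum of $\langle B\rangle$ over all quantum strategies. Convention (Jordan's lemma): local spaces are, after enlarging them where necessary (extending any $1\times1$ Jordan blocks to $2\times 2$ blocks), identified as $\mathcal H_{\tilde Q_A}=\mathcal H_{F_A}\otimes\mathcal H_{Q_A}$ and $\mathcal H_{\tilde Q_B}=\mathcal H_{F_B}\otimes\mathcal H_{Q_B}$ with $\mathcal H_{Q_A}=\mathcal H_{Q_B}=\mathbb C^2$, so that $\tilde A_x=\sum_i|i\rangle\langle i|_{F_A}\otimes A^i_x$ and $\tilde B_y=\sum_j|j\rangle\langle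 j|_{F_B}\otimes B^j_y$ with qubit observables $A^i_x$, $B^j_y$. The junk space is $\mathcal H_{\mathrm{Junk}}=\mathcal H_E\otimes\mathcal H_{F_A}\otimes\mathcal H_{F_B}$, with tensor factors reordered accordingly. *)

theory Defs
  imports Complex_Main "Jordan_Normal_Form.Schur_Decomposition"
begin

(* A finite-dimensional Hilbert space of dimension n is carrier_vec n over the complex numbers.
   The basis vector |i>|j> of a tensor product of spaces of dimensions m and n has index i * n + j,
   so that the products below are strictly associative. *)

definition kron :: "complex mat \<Rightarrow> complex mat \<Rightarrow> complex mat" (infixl "\<otimes>\<^sub>k" 75) where
  "M \<otimes>\<^sub>k N = mat (dim_row M * dim_row N) (dim_col M * dim_col N)
     (\<lambda>(i, j). M $$ (i div dim_row N, j div dim_col N) * N $$ (i mod dim_row N, j mod dim_col N))"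

definition kron_vec :: "complex vec \<Rightarrow> complex vec \<Rightarrow> complex vec" (infixl "\<otimes>\<^sub>v" 75) where
  "u \<otimes>\<^sub>v v = vec (dim_vec u * dim_vec v)
     (\<lambda>i. u $ (i div dim_vec v) * v $ (i mod dim_vec v))"

definition mat_trace :: "complex mat \<Rightarrow> complex" where
  "mat_trace M = (\<Sum>i<dim_row M. M $$ (i, i))"

definition proj :: "complex vec \<Rightarrow> complex mat" where
  "proj v = mat (dim_vec v) (dim_vec v) (\<lambda>(i, j). v $ i * cnj (v $ j))"

definition hermitian :: "complex mat \<Rightarrow> bool" where
  "hermitian M \<longleftrightarrow> mat_adjoint M = M"

definition is_unitary :: "nat \<Rightarrow> complex mat \<Rightarrow> bool" where
  "is_unitary n U \<longleftrightarrow> U \<in> carrier_mat n n \<and> mat_adjoint U * U = 1\<^sub>m n \<and> U * mat_adjoint U = 1\<^sub>m n"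

definition pure_state :: "nat \<Rightarrow> complex vec \<Rightarrow> bool" where
  "pure_state n v \<longleftrightarrow> v \<in> carrier_vec n \<and> v \<bullet>c v = 1"

definition density :: "nat \<Rightarrow> complex mat \<Rightarrow> bool" where
  "density n \<rho> \<longleftrightarrow> \<rho> \<in> carrier_mat n n \<and> hermitian \<rho> \<and>
     (\<forall>v \<in> carrier_vec n. 0 \<le> Re ((\<rho> *\<^sub>v v) \<bullet>c v)) \<and> mat_trace \<rho> = 1"

definition observable :: "nat \<Rightarrow> complex mat \<Rightarrow> bool" where
  "observable n M \<longleftrightarrow> M \<in> carrier_mat n n \<and> hermitian M \<and> M * M = 1\<^sub>m n"

(* The inputs 0 and 1 are represented by False and True. *)

definition strategy ::
  "nat \<Rightarrow> nat \<Rightarrow> complex mat \<Rightarrow> (bool \<Rightarrow> complex mat) \<Rightarrow> (bool \<Rightarrow> complex mat) \<Rightarrow> bool" where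
  "strategy dA dB \<rho> A B \<longleftrightarrow>
     density (dA * dB) \<rho> \<and> (\<forall>x. observable dA (A x)) \<and> (\<forall>y. observable dB (B y))"

record bell =
  coeff_id :: real
  coeff_A :: "bool \<Rightarrow> real"
  coeff_B :: "bool \<Rightarrow> real"
  coeff_AB :: "bool \<Rightarrow> bool \<Rightarrow> real"

definition bell_operator ::
  "bell \<Rightarrow> nat \<Rightarrow> nat \<Rightarrow> (bool \<Rightarrow> complex mat) \<Rightarrow> (bool \<Rightarrow> complex mat) \<Rightarrow> complex mat" where
  "bell_operator b dA dB A B =
     complex_of_real (coeff_id b) \<cdot>\<^sub>m 1\<^sub>m (dA * dB)
     + complex_of_real (coeff_A b False) \<cdot>\<^sub>m (A False \<otimes>\<^sub>k 1\<^sub>m dB)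
     + complex_of_real (coeff_A b True) \<cdot>\<^sub>m (A True \<otimes>\<^sub>k 1\<^sub>m dB)
     + complex_of_real (coeff_B b False) \<cdot>\<^sub>m (1\<^sub>m dA \<otimes>\<^sub>k B False)
     + complex_of_real (coeff_B b True) \<cdot>\<^sub>m (1\<^sub>m dA \<otimes>\<^sub>k B True)
     + complex_of_real (coeff_AB b False False) \<cdot>\<^sub>m (A False \<otimes>\<^sub>k B False)
     + complex_of_real (coeff_AB b False True) \<cdot>\<^sub>m (A False \<otimes>\<^sub>k B True)
     + complex_of_real (coeff_AB b True False) \<cdot>\<^sub>m (A True \<otimes>\<^sub>k B False)
     + complex_of_real (coeff_AB b True True) \<cdot>\<^sub>m (A True \<otimes>\<^sub>k B True)"

(* The trace is real for every strategy, since the state and the Bell operator are Hermitian. *)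
definition bell_value ::
  "bell \<Rightarrow> nat \<Rightarrow> nat \<Rightarrow> complex mat \<Rightarrow> (bool \<Rightarrow> complex mat) \<Rightarrow> (bool \<Rightarrow> complex mat) \<Rightarrow> real" where
  "bell_value b dA dB \<rho> A B = Re (mat_trace (\<rho> * bell_operator b dA dB A B))"

definition is_quantum_bound :: "bell \<Rightarrow> real \<Rightarrow> bool" where
  "is_quantum_bound b \<eta> \<longleftrightarrow>
     (\<exists>dA dB \<rho> A B. strategy dA dB \<rho> A B \<and> bell_value b dA dB \<rho> A B = \<eta>) \<and>
     (\<forall>dA dB \<rho> A B. strategy dA dB \<rho> A B \<longrightarrow> bell_value b dA dB \<rho> A B \<le> \<eta>)"

(* Partial trace over the first factor of a space of dimension e * d. *)
definition ptrace_fst :: "nat \<Rightarrow> nat \<Rightarrow> complex mat \<Rightarrow> complex mat" where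
  "ptrace_fst e d M = mat d d (\<lambda>(i, j). \<Sum>k<e. M $$ (k * d + i, k * d + j))"

definition purification :: "nat \<Rightarrow> nat \<Rightarrow> complex mat \<Rightarrow> complex vec \<Rightarrow> bool" where
  "purification e d \<rho> \<Psi> \<longleftrightarrow> pure_state (e * d) \<Psi> \<and> ptrace_fst e d (proj \<Psi>) = \<rho>"

(* block_sum f M is the sum over i < f of |i><i| tensor M i, for 2x2 matrices M i. *)
definition block_sum :: "nat \<Rightarrow> (nat \<Rightarrow> complex mat) \<Rightarrow> complex mat" where
  "block_sum f M = diag_block_mat (map M [0..<f])"

(* The isometry J identifies a local space of dimension d, after enlargement, with a space
   F tensor C^2 where F has dimension f. The enlarged observables are block diagonal with qubit
   observables N x i as blocks, and they extend the original observables M x. The range of J is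
   compatible with the blocks: its part in block i is the range of P i, which has dimension 2
   (a 2x2 Jordan block) or 1 (an extended 1x1 Jordan block). J is unitary if no block has been
   extended. *)
definition jordan_identification ::
  "nat \<Rightarrow> (bool \<Rightarrow> complex mat) \<Rightarrow> nat \<Rightarrow> complex mat \<Rightarrow> (bool \<Rightarrow> nat \<Rightarrow> complex mat) \<Rightarrow> bool" where
  "jordan_identification d M f J N \<longleftrightarrow>
     J \<in> carrier_mat (f * 2) d \<and> mat_adjoint J * J = 1\<^sub>m d \<and>
     (\<forall>x. \<forall>i<f. observable 2 (N x i)) \<and>
     (\<forall>x. block_sum f (N x) * J = J * M x) \<and>
     (\<exists>P. (\<forall>i<f. P i \<in> carrier_mat 2 2 \<and> P i \<noteq> 0\<^sub>m 2 2) \<and> J * mat_adjoint J = block_sum f P)"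

(* The unitary that maps u tensor v to v tensor u, for u of dimension m and v of dimension n. *)
definition swap_mat :: "nat \<Rightarrow> nat \<Rightarrow> complex mat" where
  "swap_mat m n = mat (n * m) (m * n) (\<lambda>(i, j). if i = (j mod n) * m + j div n then 1 else 0)"

(* Reorders the factors E, F_A, F_B, Q_A, Q_B as E, F_A, Q_A, F_B, Q_B. *)
definition reorder :: "nat \<Rightarrow> nat \<Rightarrow> nat \<Rightarrow> complex mat" where
  "reorder e fA fB = 1\<^sub>m (e * fA) \<otimes>\<^sub>k swap_mat fB 2 \<otimes>\<^sub>k 1\<^sub>m 2"

lemma swap_mat_kron_vec:
  assumes u: "u \<in> carrier_vec m" and v: "v \<in> carrier_vec n"
  shows "swap_mat m n *\<^sub>v (u \<otimes>\<^sub>v v) = v \<otimes>\<^sub>v u"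
proof (rule eq_vecI)
  have d: "dim_vec u = m" "dim_vec v = n" using u v by auto
  show "dim_vec (swap_mat m n *\<^sub>v (u \<otimes>\<^sub>v v)) = dim_vec (v \<otimes>\<^sub>v u)"
    by (simp add: swap_mat_def kron_vec_def d)
  fix i assume "i < dim_vec (v \<otimes>\<^sub>v u)"
  then have i: "i < n * m" by (simp add: kron_vec_def d)
  then have m: "0 < m" and n: "0 < n" by (auto intro: Nat.gr0I)
  define k where "k = (i mod m) * n + i div m"
  have b: "i div m < n" using i by (simp add: less_mult_imp_div_less)
  have kb: "k div n = i mod m" "k mod n = i div m" using b by (simp_all add: k_def)
  have k: "k < m * n"
  proof -
    have "k < (i mod m + 1) * n" using b by (simp add: k_def)
    also have "\<dots> \<le> m * n" using m by (intro mult_right_mono) (auto simp: Suc_le_eq)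
    finally show ?thesis .
  qed
  have inv: "i = (j mod n) * m + j div n \<longleftrightarrow> j = k" if "j < m * n" for j
  proof
    assume e: "i = (j mod n) * m + j div n"
    have "j div n < m" using that by (simp add: less_mult_imp_div_less)
    then have "i mod m = j div n" "i div m = j mod n" using e by simp_all
    then show "j = k" by (simp add: k_def)
  qed (simp add: kb)
  have "(swap_mat m n *\<^sub>v (u \<otimes>\<^sub>v v)) $ i =
      (\<Sum>j<m * n. (if i = (j mod n) * m + j div n then 1 else 0) * (u $ (j div n) * v $ (j mod n)))"
    using i by (simp add: swap_mat_def kron_vec_def d scalar_prod_def atLeast0LessThan)
  also have "\<dots> = (\<Sum>j<m * n. if j = k then u $ (j div n) * v $ (j mod n) else 0)"
    by (intro sum.cong refl) (simp add: inv)
  also have "\<dots> = u $ (i mod m) * v $ (i div m)" using k by (simp add: kb)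
  finally show "(swap_mat m n *\<^sub>v (u \<otimes>\<^sub>v v)) $ i = (v \<otimes>\<^sub>v u) $ i"
    using i by (simp add: kron_vec_def d)
qed

end

theory Submission
  imports Defs
begin

text \<open>
  Jordan's lemma: an eigenvector \<open>u\<close> of \<open>A\<^sub>0 A\<^sub>1\<close> spans together with \<open>A\<^sub>0 u\<close> a
  subspace of dimension at most two that is invariant under both observables. Running through a basis
  that triangularises \<open>A\<^sub>0 A\<^sub>1\<close> and splitting off the part of each basis vector that is not
  yet covered exhausts the space.

  Self-testing: cut the purification, embedded by \<open>J\<^sub>A \<otimes> J\<^sub>B\<close>, into two-qubit vectors
  \<open>\<phi> k i j\<close>, where \<open>k\<close> runs through a basis of \<open>E\<close> and \<open>i\<close>, \<open>j\<close> through the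
  blocks of Alice and Bob. The values of the \<open>\<phi> k i j\<close> are bounded by \<open>\<eta>\<close> times their
  squared norms and sum up to \<open>\<eta>\<close>, so each nonzero one is optimal and its observables can be
  rotated into the target observables. For these the optimal state is unique up to a scalar, so any
  such rotation takes \<open>\<phi> k i j\<close> to a multiple of \<open>\<psi>\<close>, although it is chosen by Alice
  knowing only \<open>i\<close> and by Bob knowing only \<open>j\<close>. The scalars are the coefficients of the
  junk state.
\<close>

section \<open>Adjoints and inner products\<close>

text \<open>The obstacle is a mismatch of dependencies. The hypothesis supplies a pair of unitaries
  for a whole two-qubit strategy, hence for a pair of blocks together with a state, whereas
  \<open>VA\<close> may look only at Alice's blocks and has to be fixed before the purification.
  Uniqueness of the optimal ray removes it: two unitaries that carry the same block observables to
  the target ones differ by a unitary commuting with the target observables, and products of such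
  unitaries preserve the Bell value, so they keep the ray of \<psi>. Uniqueness itself rests on the
  hypothesis covering mixed states. For Jordan's lemma a Schur basis suffices: the projection onto
  the covered part commutes with the observables, so what remains of the next Schur vector is zero
  or an eigenvector. A one-dimensional block is filled up to a qubit by letting the observables act
  as the identity on the added dimension.\<close>

lemma mult_mat_assoc:
  fixes A B C :: "complex mat"
  assumes "dim_col A = dim_row B" "dim_col B = dim_row C"
  shows "A * B * C = A * (B * C)"
  using assms by (intro assoc_mult_mat[of A "dim_row A" "dim_col A" B "dim_col B" C "dim_col C"]) auto

lemma dim_mat_adjoint [simp]:
  "dim_row (mat_adjoint A) = dim_col A" "dim_col (mat_adjoint A) = dim_row A"
  by (simp_all add: mat_adjoint_def)

lemma mat_adjoint_carrier [simp, intro]: "A \<in> carrier_mat m n \<Longrightarrow> mat_adjoint A \<in> carrier_mat n m"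
  by (auto intro: carrier_matI)

lemma mat_adjoint_index [simp]:
  fixes A :: "complex mat"
  assumes "i < dim_col A" "j < dim_row A"
  shows "mat_adjoint A $$ (i, j) = cnj (A $$ (j, i))"
  using assms by (simp add: mat_adjoint_def mat_of_rows_def)

lemma mat_adjoint_adjoint [simp]: "mat_adjoint (mat_adjoint A) = (A :: complex mat)"
  by (rule eq_matI) auto

lemma mat_adjoint_one [simp]: "mat_adjoint (1\<^sub>m n) = (1\<^sub>m n :: complex mat)"
  by (rule eq_matI) auto

lemma mat_adjoint_mult:
  fixes A B :: "complex mat"
  assumes "dim_col A = dim_row B"
  shows "mat_adjoint (A * B) = mat_adjoint B * mat_adjoint A"
  using assms by (intro eq_matI) (auto simp: scalar_prod_def mult.commute)

lemma mat_adjoint_add: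
  fixes A B :: "complex mat"
  assumes "dim_row A = dim_row B" "dim_col A = dim_col B"
  shows "mat_adjoint (A + B) = mat_adjoint A + mat_adjoint B"
  using assms by (intro eq_matI) auto

lemma mat_adjoint_minus:
  fixes A B :: "complex mat"
  assumes "dim_row A = dim_row B" "dim_col A = dim_col B"
  shows "mat_adjoint (A - B) = mat_adjoint A - mat_adjoint B"
  using assms by (intro eq_matI) auto

lemma mult_mat_vec_assoc:
  fixes A B :: "complex mat"
  assumes "dim_col A = dim_row B" "dim_col B = dim_vec v"
  shows "A * B *\<^sub>v v = A *\<^sub>v (B *\<^sub>v v)"
  using assms by (intro assoc_mult_mat_vec[of A "dim_row A" "dim_col A" B "dim_col B"]) (auto intro: carrier_vecI)

lemma mult_mat_vec_index:
  fixes A :: "complex mat"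
  assumes "i < dim_row A" "dim_col A = dim_vec v"
  shows "(A *\<^sub>v v) $ i = (\<Sum>j<dim_vec v. A $$ (i, j) * v $ j)"
  using assms by (auto simp: scalar_prod_def atLeast0LessThan)

lemma cscalar_prod_sum:
  fixes u v :: "complex vec"
  shows "u \<bullet>c v = (\<Sum>i<dim_vec v. u $ i * cnj (v $ i))"
  by (auto simp: scalar_prod_def atLeast0LessThan)

lemma cscalar_prod_adjoint:
  fixes A :: "complex mat"
  assumes "A \<in> carrier_mat m n" "x \<in> carrier_vec n" "y \<in> carrier_vec m"
  shows "(A *\<^sub>v x) \<bullet>c y = x \<bullet>c (mat_adjoint A *\<^sub>v y)"
proof -
  have "(A *\<^sub>v x) \<bullet>c y = (\<Sum>i<m. \<Sum>j<n. A $$ (i, j) * x $ j * cnj (y $ i))"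
    using assms by (simp add: cscalar_prod_sum mult_mat_vec_index sum_distrib_right del: index_mult_mat_vec)
  also have "\<dots> = (\<Sum>j<n. \<Sum>i<m. A $$ (i, j) * x $ j * cnj (y $ i))"
    by (rule sum.swap)
  also have "\<dots> = x \<bullet>c (mat_adjoint A *\<^sub>v y)"
    using assms by (simp add: cscalar_prod_sum mult_mat_vec_index sum_distrib_left mult_ac del: index_mult_mat_vec)
  finally show ?thesis .
qed

lemma isometry_cscalar_prod:
  fixes A :: "complex mat"
  assumes "A \<in> carrier_mat m n" "mat_adjoint A * A = 1\<^sub>m n" "x \<in> carrier_vec n" "y \<in> carrier_vec n"
  shows "(A *\<^sub>v x) \<bullet>c (A *\<^sub>v y) = x \<bullet>c y"
proof -
  have "(A *\<^sub>v x) \<bullet>c (A *\<^sub>v y) = x \<bullet>c (mat_adjoint A *\<^sub>v (A *\<^sub>v y))"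
    using assms by (intro cscalar_prod_adjoint) auto
  also have "mat_adjoint A *\<^sub>v (A *\<^sub>v y) = y"
    using assms by (subst mult_mat_vec_assoc[symmetric]) auto
  finally show ?thesis .
qed

lemma mult_mat_distrib:
  fixes A B C :: "complex mat"
  shows "dim_row A = dim_row B \<Longrightarrow> dim_col A = dim_row C \<Longrightarrow> dim_col B = dim_row C \<Longrightarrow>
      (A + B) * C = A * C + B * C"
    and "dim_row A = dim_row B \<Longrightarrow> dim_col A = dim_row C \<Longrightarrow> dim_col B = dim_row C \<Longrightarrow>
      (A - B) * C = A * C - B * C"
    and "dim_col A = dim_row B \<Longrightarrow> dim_col A = dim_row C \<Longrightarrow> dim_col B = dim_col C \<Longrightarrow>
      A * (B + C) = A * B + A * C"
    and "dim_col A = dim_row B \<Longrightarrow> dim_col A = dim_row C \<Longrightarrow> dim_col B = dim_col C \<Longrightarrow>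
      A * (B - C) = A * B - A * C"
  by (intro eq_matI;
    auto simp: scalar_prod_def sum.distrib sum_subtractf algebra_simps)+

lemma cscalar_prod_smult_right:
  fixes u v :: "complex vec"
  assumes "u \<in> carrier_vec n" "v \<in> carrier_vec n"
  shows "u \<bullet>c (c \<cdot>\<^sub>v v) = cnj c * (u \<bullet>c v)"
  using assms by (simp add: cscalar_prod_sum sum_distrib_left mult_ac)

lemma cscalar_prod_smult_left:
  fixes u v :: "complex vec"
  assumes "u \<in> carrier_vec n" "v \<in> carrier_vec n"
  shows "(c \<cdot>\<^sub>v u) \<bullet>c v = c * (u \<bullet>c v)"
  using assms by (simp add: cscalar_prod_sum sum_distrib_left mult_ac)

lemma cscalar_prod_self:
  fixes u :: "complex vec"
  shows "u \<bullet>c u = complex_of_real (\<Sum>i<dim_vec u. (cmod (u $ i))\<^sup>2)"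
  by (simp add: cscalar_prod_sum complex_norm_square[symmetric])

lemma mult_mat_zero_vec:
  fixes X :: "complex mat"
  assumes "X \<in> carrier_mat m n"
  shows "X *\<^sub>v 0\<^sub>v n = 0\<^sub>v m"
  using assms by (intro eq_vecI) (auto simp: mult_mat_vec_index simp del: index_mult_mat_vec)

lemma zero_mat_adjoint: "mat_adjoint (0\<^sub>m m n) = (0\<^sub>m n m :: complex mat)"
  by (rule eq_matI) auto

lemma zero_mat_mult_vec: "v \<in> carrier_vec n \<Longrightarrow> 0\<^sub>m m n *\<^sub>v v = (0\<^sub>v m :: complex vec)"
  by (intro eq_vecI) auto

section \<open>Kronecker products and block sums\<close>

lemma div_mod_pair [simp]:
  fixes p q n :: nat
  assumes "q < n"
  shows "(p * n + q) div n = p" "(p * n + q) mod n = q"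
  using assms by simp_all

lemma pair_less: 
  fixes p q m n :: nat
  assumes "p < m" "q < n"
  shows "p * n + q < m * n"
proof -
  have "p * n + q < (p + 1) * n" using assms by simp
  also have "\<dots> \<le> m * n" using assms by (intro mult_right_mono) auto
  finally show ?thesis .
qed

text \<open>Unfolded repeatedly, this turns a sum over a composite index into nested sums, one for
  each tensor factor.\<close>

lemma sum_pair: "(\<Sum>i<m * n. g i) = (\<Sum>p<m. \<Sum>q<n. g (p * n + q))"
  for g :: "nat \<Rightarrow> 'a::comm_monoid_add"
proof -
  have "(\<Sum>i<m * n. g i) = (\<Sum>p<m. sum g {p * n..<p * n + n})"
    by (simp add: sum.nat_group)
  also have "\<dots> = (\<Sum>p<m. \<Sum>q<n. g (p * n + q))"
  proof (rule sum.cong[OF refl])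
    fix p
    show "sum g {p * n..<p * n + n} = (\<Sum>q<n. g (p * n + q))"
      using sum.shift_bounds_nat_ivl[of g 0 "p * n" n] by (simp add: atLeast0LessThan add.commute)
  qed
  finally show ?thesis .
qed

lemma pairE:
  fixes r m n :: nat
  assumes "r < m * n"
  obtains p q where "r = p * n + q" "p < m" "q < n"
proof
  have "0 < n" using assms by (auto intro: Nat.gr0I)
  then show "r mod n < n" by simp
  show "r div n < m" using assms by (simp add: less_mult_imp_div_less)
  show "r = r div n * n + r mod n" by simp
qed

lemma dim_kron [simp]:
  "dim_row (M \<otimes>\<^sub>k N) = dim_row M * dim_row N" "dim_col (M \<otimes>\<^sub>k N) = dim_col M * dim_col N"
  by (simp_all add: kron_def)

lemma kron_carrier [simp, intro]:
  "M \<in> carrier_mat m m' \<Longrightarrow> N \<in> carrier_mat n n' \<Longrightarrow> M \<otimes>\<^sub>k N \<in> carrier_mat (m * n) (m' * n')"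
  by (auto simp: kron_def)

lemma kron_index:
  assumes "M \<in> carrier_mat m m'" "N \<in> carrier_mat n n'" "p < m" "q < n" "p' < m'" "q' < n'"
  shows "(M \<otimes>\<^sub>k N) $$ (p * n + q, p' * n' + q') = M $$ (p, p') * N $$ (q, q')"
  using assms pair_less[of p m q n] pair_less[of p' m' q' n'] by (simp add: kron_def)

lemma kron_eqI:
  assumes X: "X \<in> carrier_mat (m * n) (m' * n')" and Y: "Y \<in> carrier_mat (m * n) (m' * n')"
    and "\<And>p q p' q'. p < m \<Longrightarrow> q < n \<Longrightarrow> p' < m' \<Longrightarrow> q' < n' \<Longrightarrow>
      X $$ (p * n + q, p' * n' + q') = Y $$ (p * n + q, p' * n' + q')"
  shows "X = Y"
proof (rule eq_matI)
  fix i j assume "i < dim_row Y" "j < dim_col Y"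
  then have "i < m * n" "j < m' * n'" using Y by auto
  then show "X $$ (i, j) = Y $$ (i, j)" using assms(3) by (elim pairE) simp
qed (use X Y in auto)

lemma mult_mat_index:
  fixes A :: "complex mat"
  assumes "A \<in> carrier_mat m n" "B \<in> carrier_mat n k" "i < m" "j < k"
  shows "(A * B) $$ (i, j) = (\<Sum>l<n. A $$ (i, l) * B $$ (l, j))"
  using assms by (auto simp: scalar_prod_def atLeast0LessThan)

lemma kron_mult:
  assumes M: "M \<in> carrier_mat m k" and N: "N \<in> carrier_mat n l"
    and M': "M' \<in> carrier_mat k m'" and N': "N' \<in> carrier_mat l n'"
  shows "(M \<otimes>\<^sub>k N) * (M' \<otimes>\<^sub>k N') = (M * M') \<otimes>\<^sub>k (N * N')"
proof (rule kron_eqI)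
  fix p q p' q' assume pq: "p < m" "q < n" "p' < m'" "q' < n'"
  have "((M \<otimes>\<^sub>k N) * (M' \<otimes>\<^sub>k N')) $$ (p * n + q, p' * n' + q') =
     (\<Sum>r<k * l. (M \<otimes>\<^sub>k N) $$ (p * n + q, r) * (M' \<otimes>\<^sub>k N') $$ (r, p' * n' + q'))"
    using pq by (intro mult_mat_index[OF kron_carrier[OF M N] kron_carrier[OF M' N']] pair_less)
  also have "\<dots> = (\<Sum>r<k. \<Sum>s<l. (M $$ (p, r) * M' $$ (r, p')) * (N $$ (q, s) * N' $$ (s, q')))"
    unfolding sum_pair using pq
    by (intro sum.cong refl) (simp add: kron_index[OF M N] kron_index[OF M' N'])
  also have "\<dots> = (\<Sum>r<k. M $$ (p, r) * M' $$ (r, p')) * (\<Sum>s<l. N $$ (q, s) * N' $$ (s, q'))"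
    by (simp add: sum_product)
  also have "\<dots> = (M * M') $$ (p, p') * (N * N') $$ (q, q')"
    using pq by (simp only: mult_mat_index[OF M M'] mult_mat_index[OF N N'])
  also have "\<dots> = ((M * M') \<otimes>\<^sub>k (N * N')) $$ (p * n + q, p' * n' + q')"
    using pq M N M' N' by (intro kron_index[symmetric]) auto
  finally show "((M \<otimes>\<^sub>k N) * (M' \<otimes>\<^sub>k N')) $$ (p * n + q, p' * n' + q') =
    ((M * M') \<otimes>\<^sub>k (N * N')) $$ (p * n + q, p' * n' + q')" .
qed (use assms in \<open>auto intro: kron_carrier mult_carrier_mat\<close>)

lemma kron_one [simp]: "1\<^sub>m m \<otimes>\<^sub>k 1\<^sub>m n = 1\<^sub>m (m * n)"
proof (rule kron_eqI)
  fix p q p' q' assume pq: "p < m" "q < n" "p' < m" "q' < n"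
  have "p * n + q = p' * n + q' \<longleftrightarrow> p = p' \<and> q = q'"
    using pq by (metis div_mod_pair)
  then show "(1\<^sub>m m \<otimes>\<^sub>k 1\<^sub>m n) $$ (p * n + q, p' * n + q') = 1\<^sub>m (m * n) $$ (p * n + q, p' * n + q')"
    using pq pair_less[of p m q n] pair_less[of p' m q' n]
    by (auto simp: kron_index[of _ m m _ n n])
qed (auto intro: kron_carrier)

lemma mat_adjoint_kron: "mat_adjoint (M \<otimes>\<^sub>k N) = mat_adjoint M \<otimes>\<^sub>k mat_adjoint N"
proof (rule kron_eqI)
  fix p q p' q' assume pq: "p < dim_col M" "q < dim_col N" "p' < dim_row M" "q' < dim_row N"
  then show "mat_adjoint (M \<otimes>\<^sub>k N) $$ (p * dim_col N + q, p' * dim_row N + q') =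
     (mat_adjoint M \<otimes>\<^sub>k mat_adjoint N) $$ (p * dim_col N + q, p' * dim_row N + q')"
    using pair_less[of p "dim_col M" q "dim_col N"] pair_less[of p' "dim_row M" q' "dim_row N"]
    by (simp add: kron_def)
qed (auto intro: carrier_matI)

text \<open>Regroups the left-nested products of the theorem so that the operators of Alice and Bob
  form one factor next to the identity on E.\<close>

lemma kron_assoc: "L \<otimes>\<^sub>k M \<otimes>\<^sub>k N = L \<otimes>\<^sub>k (M \<otimes>\<^sub>k N)"
proof (rule eq_matI)
  fix i j
  assume "i < dim_row (L \<otimes>\<^sub>k (M \<otimes>\<^sub>k N))" "j < dim_col (L \<otimes>\<^sub>k (M \<otimes>\<^sub>k N))"
  then have i: "i < dim_row L * dim_row M * dim_row N" and j: "j < dim_col L * dim_col M * dim_col N"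
    by (simp_all add: mult.assoc)
  from i obtain i' i3 where i': "i = i' * dim_row N + i3" "i' < dim_row L * dim_row M" "i3 < dim_row N"
    by (rule pairE)
  from i'(2) obtain i1 i2 where i12: "i' = i1 * dim_row M + i2" "i1 < dim_row L" "i2 < dim_row M"
    by (rule pairE)
  from j obtain j' j3 where j': "j = j' * dim_col N + j3" "j' < dim_col L * dim_col M" "j3 < dim_col N"
    by (rule pairE)
  from j'(2) obtain j1 j2 where j12: "j' = j1 * dim_col M + j2" "j1 < dim_col L" "j2 < dim_col M"
    by (rule pairE)
  have C: "X \<in> carrier_mat (dim_row X) (dim_col X)" for X :: "complex mat" by auto
  have "(L \<otimes>\<^sub>k M \<otimes>\<^sub>k N) $$ (i, j) = L $$ (i1, j1) * M $$ (i2, j2) * N $$ (i3, j3)"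
    unfolding i' j' using i' j' i12 j12
    by (simp add: kron_index[OF kron_carrier[OF C C] C] kron_index[OF C C])
  moreover have "i = i1 * (dim_row M * dim_row N) + (i2 * dim_row N + i3)"
    "j = j1 * (dim_col M * dim_col N) + (j2 * dim_col N + j3)"
    unfolding i' i12 j' j12 by (simp_all add: algebra_simps)
  then have "(L \<otimes>\<^sub>k (M \<otimes>\<^sub>k N)) $$ (i, j) = L $$ (i1, j1) * (M $$ (i2, j2) * N $$ (i3, j3))"
    using i'(3) j'(3) i12(2,3) j12(2,3)
    by (simp only: kron_index[OF C kron_carrier[OF C C]] kron_index[OF C C] pair_less)
  ultimately show "(L \<otimes>\<^sub>k M \<otimes>\<^sub>k N) $$ (i, j) = (L \<otimes>\<^sub>k (M \<otimes>\<^sub>k N)) $$ (i, j)"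
    by (simp add: mult.assoc)
qed (auto simp: mult.assoc)

lemma kron_mult_vec_index:
  assumes M: "M \<in> carrier_mat m m'" and N: "N \<in> carrier_mat n n'" and v: "v \<in> carrier_vec (m' * n')"
    and pq: "p < m" "q < n"
  shows "((M \<otimes>\<^sub>k N) *\<^sub>v v) $ (p * n + q) =
    (\<Sum>p'<m'. \<Sum>q'<n'. M $$ (p, p') * N $$ (q, q') * v $ (p' * n' + q'))"
proof -
  have "((M \<otimes>\<^sub>k N) *\<^sub>v v) $ (p * n + q) = (\<Sum>r<m' * n'. (M \<otimes>\<^sub>k N) $$ (p * n + q, r) * v $ r)"
    using assms pair_less[OF pq] by (subst mult_mat_vec_index) auto
  also have "\<dots> = (\<Sum>p'<m'. \<Sum>q'<n'. M $$ (p, p') * N $$ (q, q') * v $ (p' * n' + q'))"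
    unfolding sum_pair using pq by (intro sum.cong refl) (simp add: kron_index[OF M N])
  finally show ?thesis .
qed

section \<open>Block-diagonal matrices with qubit blocks\<close>

lemma block_sum_carrier:
  assumes "\<And>i. i < f \<Longrightarrow> X i \<in> carrier_mat 2 2"
  shows "block_sum f X \<in> carrier_mat (f * 2) (f * 2)"
proof -
  have "map (dim_row \<circ> X) [0..<f] = map (\<lambda>_. 2) [0..<f]" "map (dim_col \<circ> X) [0..<f] = map (\<lambda>_. 2) [0..<f]"
    using assms[THEN carrier_matD(1)] assms[THEN carrier_matD(2)] by auto
  then show ?thesis
    by (intro carrier_matI) (simp_all add: block_sum_def dim_diag_block_mat map_replicate_const sum_list_replicate)
qed

lemma block_sum_Suc:
  "block_sum (Suc f) X = four_block_mat (block_sum f X) (0\<^sub>m (dim_row (block_sum f X)) (dim_col (X f)))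
     (0\<^sub>m (dim_row (X f)) (dim_col (block_sum f X))) (X f)"
  by (simp add: block_sum_def diag_block_mat_last Let_def)

lemma block_sum_index:
  assumes "\<And>i. i < f \<Longrightarrow> X i \<in> carrier_mat 2 2" "i < f" "i' < f" "a < 2" "a' < 2"
  shows "block_sum f X $$ (i * 2 + a, i' * 2 + a') = (if i = i' then X i $$ (a, a') else 0)"
  using assms
proof (induction f)
  case (Suc f)
  have c: "block_sum f X \<in> carrier_mat (f * 2) (f * 2)" using Suc.prems by (intro block_sum_carrier) auto
  have x: "X f \<in> carrier_mat 2 2" using Suc.prems by auto
  \<comment> \<open>A position lies before the border of the last block exactly if its block number
    is below \<open>f\<close>; this decides which of the four quadrants an entry belongs to.\<close>
  have lt: "r * 2 + s < f * 2 \<longleftrightarrow> r < f" if "s < 2" for r s using that by auto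
  have lt': "r * 2 + s < Suc f * 2" if "r < Suc f" "s < 2" for r s
    using pair_less[OF that] .
  have "block_sum (Suc f) X $$ (i * 2 + a, i' * 2 + a') =
    (if i * 2 + a < f * 2 then if i' * 2 + a' < f * 2 then block_sum f X $$ (i * 2 + a, i' * 2 + a')
      else 0\<^sub>m (f * 2) 2 $$ (i * 2 + a, i' * 2 + a' - f * 2)
     else if i' * 2 + a' < f * 2 then 0\<^sub>m 2 (f * 2) $$ (i * 2 + a - f * 2, i' * 2 + a')
      else X f $$ (i * 2 + a - f * 2, i' * 2 + a' - f * 2))"
    unfolding block_sum_Suc using c x Suc.prems(2-) lt'[of i a] lt'[of i' a']
    by (subst index_mat_four_block) auto
  then show ?case using Suc.prems Suc.IH
    by (auto simp: lt less_Suc_eq)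
qed simp

lemma block_sum_eqI:
  assumes "Y \<in> carrier_mat (f * 2) (f * 2)" "\<And>i. i < f \<Longrightarrow> X i \<in> carrier_mat 2 2"
    and "\<And>i a i' a'. i < f \<Longrightarrow> a < 2 \<Longrightarrow> i' < f \<Longrightarrow> a' < 2 \<Longrightarrow>
      Y $$ (i * 2 + a, i' * 2 + a') = (if i = i' then X i $$ (a, a') else 0)"
  shows "Y = block_sum f X"
  using assms by (intro kron_eqI[of Y f 2 f 2]) (auto simp: block_sum_carrier block_sum_index)

lemma block_sum_adjoint:
  assumes "\<And>i. i < f \<Longrightarrow> X i \<in> carrier_mat 2 2"
  shows "mat_adjoint (block_sum f X) = block_sum f (\<lambda>i. mat_adjoint (X i))"
  using assms block_sum_carrier[of f X] 
  by (intro block_sum_eqI)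
    (auto simp: block_sum_index pair_less assms[THEN carrier_matD(1)] assms[THEN carrier_matD(2)])

lemma block_sum_one: "block_sum f (\<lambda>i. 1\<^sub>m 2) = 1\<^sub>m (f * 2)"
proof (rule block_sum_eqI[symmetric])
  fix i a i' a' assume i: "i < f" "a < (2::nat)" "i' < f" "a' < (2::nat)"
  then have "i * 2 + a = i' * 2 + a' \<longleftrightarrow> i = i' \<and> a = a'"
    by (metis div_mod_pair)
  then show "1\<^sub>m (f * 2) $$ (i * 2 + a, i' * 2 + a') = (if i = i' then 1\<^sub>m 2 $$ (a, a') else 0)"
    using i by (auto simp: pair_less)
qed auto

lemma block_sum_mult:
  assumes X: "\<And>i. i < f \<Longrightarrow> X i \<in> carrier_mat 2 2" and Y: "\<And>i. i < f \<Longrightarrow> Y i \<in> carrier_mat 2 2"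
  shows "block_sum f X * block_sum f Y = block_sum f (\<lambda>i. X i * Y i)"
proof (rule block_sum_eqI)
  fix i a i' a' assume i: "i < f" "a < (2::nat)" "i' < f" "a' < (2::nat)"
  have "(block_sum f X * block_sum f Y) $$ (i * 2 + a, i' * 2 + a') =
    (\<Sum>r<f * 2. block_sum f X $$ (i * 2 + a, r) * block_sum f Y $$ (r, i' * 2 + a'))"
    by (intro mult_mat_index[OF block_sum_carrier block_sum_carrier] X Y pair_less i)
  also have "\<dots> = (\<Sum>j<f. \<Sum>c<2. if j = i then if i = i' then X i $$ (a, c) * Y i $$ (c, a') else 0 else 0)"
    unfolding sum_pair using i by (intro sum.cong refl) (auto simp: block_sum_index X Y)
  also have "\<dots> = (if i = i' then (\<Sum>c<2. X i $$ (a, c) * Y i $$ (c, a')) else 0)"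
    using i by (subst sum.swap) simp
  also have "\<dots> = (if i = i' then (X i * Y i) $$ (a, a') else 0)"
    using i by (simp add: mult_mat_index[OF X Y])
  finally show "(block_sum f X * block_sum f Y) $$ (i * 2 + a, i' * 2 + a') =
     (if i = i' then (X i * Y i) $$ (a, a') else 0)" .
qed (use assms in \<open>auto intro!: mult_carrier_mat block_sum_carrier\<close>)

section \<open>Jordan's lemma\<close>

lemma observableD:
  assumes "observable n A"
  shows "A \<in> carrier_mat n n" "mat_adjoint A = A" "A * A = 1\<^sub>m n"
  using assms by (auto simp: observable_def hermitian_def)

text \<open>The equation for \<open>R\<close> says that \<open>R\<close> is a partial isometry;
  taking adjoints on both sides shows that so is its adjoint.\<close>

lemma partial_isometry_adjoint:
  fixes R :: "complex mat"
  assumes R: "R \<in> carrier_mat m d" and RSR: "R * mat_adjoint R * R = R"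
  shows "mat_adjoint R * R * mat_adjoint R = mat_adjoint R"
proof -
  have "mat_adjoint (R * mat_adjoint R * R) = mat_adjoint R * (R * mat_adjoint R)"
    using R by (simp add: mat_adjoint_mult mat_adjoint_mult)
  then show ?thesis
    using R RSR by (simp add: assoc_mult_mat[of _ d m _ d _ m])
qed

text \<open>The subspace onto which \<open>mat_adjoint R * R\<close> projects is invariant under
  \<open>A\<close>, and \<open>R\<close> maps it isometrically onto its own range. There
  \<open>N\<close> is the transported \<open>A\<close>; on the orthogonal complement it is the
  identity, so that it stays a Hermitian involution. This is the extension of a one-dimensional
  Jordan block to a qubit.\<close>

lemma compressed_observable:
  fixes R A :: "complex mat"
  assumes R: "R \<in> carrier_mat m d" and RSR: "R * mat_adjoint R * R = R"
    and A: "observable d A" and comm: "mat_adjoint R * R * A = A * (mat_adjoint R * R)"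
  defines "N \<equiv> R * A * mat_adjoint R + (1\<^sub>m m - R * mat_adjoint R)"
  shows "observable m N" and "N * R = R * A"
proof -
  define S where "S = mat_adjoint R"
  note Ad = observableD[OF A]
  have S: "S \<in> carrier_mat d m" and AC: "A \<in> carrier_mat d d" using R Ad by (auto simp: S_def)
  have SRS: "S * R * S = S" unfolding S_def by (rule partial_isometry_adjoint[OF R RSR])
  note D = carrier_matD[OF R] carrier_matD[OF S] carrier_matD[OF AC]
  have RS: "R * S \<in> carrier_mat m m" and SR: "S * R \<in> carrier_mat d d"
    and RA: "R * A \<in> carrier_mat m d" and RAS: "R * A * S \<in> carrier_mat m m" using R S AC by auto
  \<comment> \<open>Since \<open>A\<close> commutes with the projection \<open>S * R\<close>, the
    projection can be moved next to \<open>R\<close>, which absorbs it.\<close>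
  have RASR: "R * A * S * R = R * A"
  proof -
    have "R * A * S * R = R * (A * (S * R))" by (simp add: mult_mat_assoc D)
    also have "\<dots> = R * (S * R * A)" using comm by (simp add: S_def)
    also have "\<dots> = R * S * R * A" by (simp add: mult_mat_assoc D)
    finally show ?thesis by (simp only: RSR[folded S_def])
  qed
  have RSRS: "R * S * (R * S) = R * S"
  proof -
    have "R * S * (R * S) = R * (S * R * S)" by (simp add: mult_mat_assoc D)
    then show ?thesis by (simp only: SRS)
  qed
  have XX: "R * A * S * (R * A * S) = R * S"
  proof -
    have "R * A * S * (R * A * S) = R * A * S * R * (A * S)" by (simp add: mult_mat_assoc D)
    also have "\<dots> = R * (A * A) * S" unfolding RASR by (simp add: mult_mat_assoc D)
    finally show ?thesis using R by (simp add: Ad)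
  qed
  have XY: "R * A * S * (R * S) = R * A * S"
  proof -
    have "R * A * S * (R * S) = R * A * S * R * S" by (simp add: mult_mat_assoc D)
    then show ?thesis by (simp only: RASR)
  qed
  have RSRAS: "R * S * (R * A * S) = R * A * S"
  proof -
    have "R * S * (R * A * S) = R * S * R * A * S" by (simp add: mult_mat_assoc D)
    then show ?thesis by (simp only: RSR[folded S_def])
  qed
  have Nc: "N \<in> carrier_mat m m" by (intro carrier_matI) (auto simp: N_def S_def[symmetric] D)
  have "mat_adjoint (R * S) = R * S"
    using R S by (simp add: mat_adjoint_mult S_def)
  moreover have "mat_adjoint (R * A * S) = R * A * S"
    by (simp add: mat_adjoint_mult mult_mat_assoc D Ad S_def)
  ultimately have "mat_adjoint N = N"
    using RAS RS by (simp add: N_def S_def[symmetric] mat_adjoint_add mat_adjoint_minus D)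
  \<comment> \<open>Left multiplication by \<open>N\<close> exchanges \<open>R * A * S\<close> and
    \<open>R * S\<close>, because \<open>A\<close> squares to one. In the expansion of
    \<open>N * N\<close> everything but the identity then cancels.\<close>
  moreover have "N * N = 1\<^sub>m m"
  proof -
    have 1: "N * (R * A * S) = R * S"
    proof -
      have "N * (R * A * S) = R * A * S * (R * A * S) + (1\<^sub>m m * (R * A * S) - R * S * (R * A * S))"
        unfolding N_def S_def[symmetric] 
        by (simp add: mult_mat_distrib D del: assoc_mult_mat)
      also have "\<dots> = R * S" 
        unfolding XX RSRAS left_mult_one_mat[OF RAS] by (intro eq_matI) (auto simp: D)
      finally show ?thesis .
    qed
    have 2: "N * (R * S) = R * A * S"
    proof -
      have "N * (R * S) = R * A * S * (R * S) + (1\<^sub>m m * (R * S) - R * S * (R * S))"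
        unfolding N_def S_def[symmetric] 
        by (simp add: mult_mat_distrib D del: assoc_mult_mat)
      also have "\<dots> = R * A * S" 
        unfolding XY RSRS left_mult_one_mat[OF RS] by (intro eq_matI) (auto simp: D)
      finally show ?thesis .
    qed
    have "N * N = N * (R * A * S + (1\<^sub>m m - R * S))" by (simp add: N_def S_def)
    also have "\<dots> = N * (R * A * S) + (N * 1\<^sub>m m - N * (R * S))"
      by (simp add: mult_mat_distrib D carrier_matD[OF Nc] del: assoc_mult_mat)
    also have "\<dots> = R * S + (N - R * A * S)" using Nc by (simp only: 1 2 right_mult_one_mat)
    also have "\<dots> = 1\<^sub>m m" unfolding N_def S_def[symmetric] 
      by (intro eq_matI) (auto simp: D)
    finally show ?thesis .
  qed
  ultimately show "observable m N" using Nc by (simp add: observable_def hermitian_def)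
  have "N * R = R * A * S * R + (1\<^sub>m m * R - R * S * R)"
    unfolding N_def S_def[symmetric] 
    by (simp add: mult_mat_distrib D del: assoc_mult_mat)
  also have "\<dots> = R * A" 
    unfolding RASR RSR[folded S_def] left_mult_one_mat[OF R] by (intro eq_matI) (auto simp: D)
  finally show "N * R = R * A" .
qed

text \<open>The two rows of \<open>R\<close> are the normalised eigenvectors \<open>u + A\<^sub>0 u\<close> and \<open>u - A\<^sub>0 u\<close> of \<open>A\<^sub>0\<close>; a row
  vanishes exactly if \<open>u\<close> spans a one-dimensional Jordan block.\<close>
lemma invariant_block_exists:
  fixes A0 A1 :: "complex mat" and u :: "complex vec"
  assumes A0: "observable d A0" and A1: "observable d A1"
    and u: "u \<in> carrier_vec d" "u \<noteq> 0\<^sub>v d" and ev: "A0 *\<^sub>v (A1 *\<^sub>v u) = \<mu> \<cdot>\<^sub>v u"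
  obtains R where "R \<in> carrier_mat 2 d" "R * mat_adjoint R * R = R"
    "mat_adjoint R * R * A0 = A0 * (mat_adjoint R * R)"
    "mat_adjoint R * R * A1 = A1 * (mat_adjoint R * R)"
    "(mat_adjoint R * R) *\<^sub>v u = u"
    "\<And>T. T \<in> carrier_mat d d \<Longrightarrow> T * A0 = A0 * T \<Longrightarrow> T *\<^sub>v u = 0\<^sub>v d \<Longrightarrow> T * mat_adjoint R = 0\<^sub>m d 2"
proof -
  note O = observableD[OF A0] observableD[OF A1]
  define z where "z = A0 *\<^sub>v u"
  have z: "z \<in> carrier_vec d" using O u by (auto simp: z_def)
  have invol: "A *\<^sub>v (A *\<^sub>v v) = v" if "observable d A" "v \<in> carrier_vec d" for A v
  proof -
    have "A *\<^sub>v (A *\<^sub>v v) = A * A *\<^sub>v v"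
      using observableD(1)[OF that(1)] that(2) by (subst mult_mat_vec_assoc) auto
    then show ?thesis using observableD(3)[OF that(1)] that(2) by simp
  qed
  have A0z: "A0 *\<^sub>v z = u" using invol[OF A0 u(1)] by (simp add: z_def)
  \<comment> \<open>The involution \<open>A0\<close> is applied to \<open>ev\<close>. On the span of
    \<open>u\<close> and \<open>z\<close>, \<open>A0\<close> exchanges the two vectors, and
    \<open>A1\<close> does so up to the factors \<open>\<mu>\<close> and
    \<open>1 / \<mu>\<close>.\<close>
  have A1u: "A1 *\<^sub>v u = \<mu> \<cdot>\<^sub>v z"
  proof -
    have "A1 *\<^sub>v u = A0 *\<^sub>v (A0 *\<^sub>v (A1 *\<^sub>v u))" using invol[OF A0, of "A1 *\<^sub>v u"] O u by auto
    also have "\<dots> = \<mu> \<cdot>\<^sub>v z" using O u by (simp add: ev z_def mult_mat_vec[of _ d d])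
    finally show ?thesis .
  qed
  have "u = \<mu> \<cdot>\<^sub>v (A1 *\<^sub>v z)"
    using invol[OF A1 u(1)] O z by (simp add: A1u mult_mat_vec[of _ d d])
  then have l0: "\<mu> \<noteq> 0" and "A1 *\<^sub>v z = (1 / \<mu>) \<cdot>\<^sub>v u"
    using u(2) O z by (auto simp: smult_smult_assoc)
  then have A1z: "A1 *\<^sub>v z = (1 / \<mu>) \<cdot>\<^sub>v u" by blast
  \<comment> \<open>The eigenvalues of \<open>A0\<close>: \<open>h 0\<close> belongs to 1 and
    \<open>h 1\<close> to -1.\<close>
  define s where "s = (\<lambda>a::nat. if a = 0 then 1 else - 1 :: complex)"
  define h where "h = (\<lambda>a. u + s a \<cdot>\<^sub>v z)"
  have h: "h a \<in> carrier_vec d" for a using u z by (simp add: h_def)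
  have ss: "s a * s a = 1" "cnj (s a) = s a" for a by (simp_all add: s_def)
  have A0h: "A0 *\<^sub>v h a = s a \<cdot>\<^sub>v h a" for a
  proof -
    have "A0 *\<^sub>v h a = z + s a \<cdot>\<^sub>v u"
      using O u z by (simp add: h_def mult_add_distrib_mat_vec[of _ d d] mult_mat_vec[of _ d d] A0z z_def[symmetric])
    also have "\<dots> = s a \<cdot>\<^sub>v h a"
      using u z ss by (intro eq_vecI) (auto simp: h_def algebra_simps mult.assoc[symmetric])
    finally show ?thesis .
  qed
  \<comment> \<open>If \<open>h a\<close> vanishes, division by zero makes \<open>c a\<close> zero,
    so \<open>c a = 0\<close> marks exactly the vanishing rows.\<close>
  define c where "c = (\<lambda>a. complex_of_real (1 / sqrt (\<Sum>i<d. (cmod (h a $ i))\<^sup>2)))"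
  have cc: "cnj (c a) = c a" for a by (simp add: c_def)
  have hh: "h a \<bullet>c h b = (if a = b then complex_of_real (\<Sum>i<d. (cmod (h a $ i))\<^sup>2) else 0)"
    if "a < 2" "b < 2" for a b
  proof (cases "a = b")
    case True then show ?thesis using h[of b] by (simp add: cscalar_prod_self)
  next
    case False
    \<comment> \<open>Eigenvectors of a Hermitian matrix for the distinct eigenvalues
      \<open>s a\<close> and \<open>s b\<close> are orthogonal.\<close>
    have "s a * (h a \<bullet>c h b) = (A0 *\<^sub>v h a) \<bullet>c h b" using h by (simp add: A0h cscalar_prod_smult_left[of _ d])
    also have "\<dots> = h a \<bullet>c (A0 *\<^sub>v h b)" using O h by (simp add: cscalar_prod_adjoint[of _ d d])
    also have "\<dots> = s b * (h a \<bullet>c h b)" using h ss by (simp add: A0h cscalar_prod_smult_right[of _ d])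
    finally have "(s a - s b) * (h a \<bullet>c h b) = 0" by (simp add: algebra_simps)
    moreover have "s a \<noteq> s b" using False that by (auto simp: s_def)
    ultimately show ?thesis using False by simp
  qed
  have c0: "h a $ i = 0" if "c a = 0" "i < d" for a i
  proof -
    have "(\<Sum>i<d. (cmod (h a $ i))\<^sup>2) = 0" using that(1) by (simp add: c_def)
    then show ?thesis using that(2) by (subst (asm) sum_nonneg_eq_0_iff) auto
  qed
  define R where "R = mat 2 d (\<lambda>(a, i). c a * cnj (h a $ i))"
  define S where "S = mat_adjoint R"
  have R: "R \<in> carrier_mat 2 d" and S: "S \<in> carrier_mat d 2" by (auto simp: R_def S_def)
  have Ri: "R $$ (a, i) = c a * cnj (h a $ i)" if "a < 2" "i < d" for a i using that by (simp add: R_def)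
  have Si: "S $$ (i, a) = c a * h a $ i" if "a < 2" "i < d" for a i
    using that R by (simp add: S_def Ri cc)
  have colS: "col S a = c a \<cdot>\<^sub>v h a" if "a < 2" for a
    using that S h[of a] by (intro eq_vecI) (auto simp: Si)
  \<comment> \<open>\<open>R * S\<close> is diagonal with entries 0 and 1, the zeros belonging to
    vanishing rows. This makes \<open>R\<close> a partial isometry.\<close>
  have RSi: "(R * S) $$ (a, b) = (if a = b \<and> c a \<noteq> 0 then 1 else 0)" if "a < 2" "b < 2" for a b
  proof -
    have "(R * S) $$ (a, b) = c a * c b * (h b \<bullet>c h a)"
      using that h by (simp add: mult_mat_index[OF R S] Ri Si cscalar_prod_sum sum_distrib_left mult_ac carrier_vecD[OF h])
    also have "\<dots> = (if a = b \<and> c a \<noteq> 0 then 1 else 0)"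
    proof (cases "a = b \<and> c a \<noteq> 0")
      case True
      define q where "q = (\<Sum>i<d. (cmod (h a $ i))\<^sup>2)"
      have "q \<ge> 0" by (simp add: q_def sum_nonneg)
      moreover have "q \<noteq> 0" using True by (auto simp: c_def q_def)
      ultimately have "1 / sqrt q * (1 / sqrt q) * q = 1" by simp
      then have "complex_of_real (1 / sqrt q * (1 / sqrt q) * q) = 1" by (simp only: of_real_1)
      moreover have "c a = complex_of_real (1 / sqrt q)" by (simp add: c_def q_def)
      moreover have "h b \<bullet>c h a = complex_of_real q"
        using True that by (simp only: hh q_def refl if_True)
      ultimately show ?thesis using True by (simp only: of_real_mult) simp
    next
      case False then show ?thesis using that by (auto simp: hh)
    qed
    finally show ?thesis .
  qed
  have RSR: "R * S * R = R"
  proof (rule eq_matI)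
    fix a i assume "a < dim_row R" "i < dim_col R"
    then have ai: "a < 2" "i < d" using R by auto
    have "(R * S * R) $$ (a, i) = (\<Sum>b<2. (R * S) $$ (a, b) * R $$ (b, i))"
      using ai R S by (intro mult_mat_index) auto
    also have "\<dots> = (\<Sum>b<2. if b = a then R $$ (a, i) else 0)"
      using ai by (intro sum.cong refl) (auto simp: RSi Ri)
    finally show "(R * S * R) $$ (a, i) = R $$ (a, i)" using ai by simp
  qed (use R S in auto)
  have SRS: "S * R * S = S"
    unfolding S_def by (rule partial_isometry_adjoint[OF R RSR[unfolded S_def]])
  define Q where "Q = S * R"
  have Q: "Q \<in> carrier_mat d d" using R S by (auto simp: Q_def)
  note D = carrier_matD[OF R] carrier_matD[OF S] carrier_matD[OF Q]
  have Qadj: "mat_adjoint Q = Q" by (simp add: Q_def mat_adjoint_mult S_def)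
  have Qh: "Q *\<^sub>v h a = h a" if "a < 2" for a
  proof (cases "c a = 0")
    case True
    then have "h a = 0\<^sub>v d" using h[of a] c0 by (intro eq_vecI) auto
    then show ?thesis using Q by auto
  next
    case False
    have "c a \<cdot>\<^sub>v (Q *\<^sub>v h a) = Q *\<^sub>v col S a" using that Q h by (simp add: colS mult_mat_vec[of _ d d])
    also have "\<dots> = col (Q * S) a" using that col_mult2[OF Q S] by simp
    also have "\<dots> = c a \<cdot>\<^sub>v h a" using that by (simp add: Q_def SRS colS)
    finally have "(1 / c a) \<cdot>\<^sub>v (c a \<cdot>\<^sub>v (Q *\<^sub>v h a)) = (1 / c a) \<cdot>\<^sub>v (c a \<cdot>\<^sub>v h a)" by simp
    then show ?thesis using False by (simp add: smult_smult_assoc)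
  qed
  have uh: "u = (1 / 2) \<cdot>\<^sub>v (h 0 + h 1)" "z = (1 / 2) \<cdot>\<^sub>v (h 0 - h 1)"
    using u z by (auto simp: h_def s_def intro!: eq_vecI)
  have Qu: "Q *\<^sub>v u = u" and Qz: "Q *\<^sub>v z = z"
    by (subst (1 2) uh, use Q h in \<open>simp add: mult_mat_vec[of _ d d] mult_add_distrib_mat_vec[of _ d d]
      mult_minus_distrib_mat_vec[of _ d d] Qh\<close>)+
  \<comment> \<open>Invariance of the range of \<open>Q\<close> reads
    \<open>Q * A * Q = A * Q\<close>. Both matrices are Hermitian, so the adjoint equation is
    \<open>Q * A * Q = Q * A\<close>, and the two together give commutation.\<close>
  have comm: "Q * A = A * Q" if A: "observable d A" and AS: "\<And>a. a < 2 \<Longrightarrow> Q *\<^sub>v (A *\<^sub>v h a) = A *\<^sub>v h a" for A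
  proof -
    note OA = observableD[OF A]
    note OD = carrier_matD[OF OA(1)]
    have "Q * (A * S) = A * S"
    proof (rule mat_col_eqI)
      fix a assume "a < dim_col (A * S)"
      then have a: "a < 2" using S by simp
      have "col (Q * (A * S)) a = Q *\<^sub>v (A *\<^sub>v col S a)"
        using a by (simp only: col_mult2[OF Q mult_carrier_mat[OF OA(1) S]] col_mult2[OF OA(1) S])
      also have "\<dots> = A *\<^sub>v col S a"
        using a OA h Q by (simp add: colS mult_mat_vec[of _ d d] AS)
      also have "\<dots> = col (A * S) a" using a by (simp only: col_mult2[OF OA(1) S])
      finally show "col (Q * (A * S)) a = col (A * S) a" .
    qed (use OA S Q in auto)
    then have "Q * (A * S) * R = A * S * R" by simp
    then have e: "Q * A * Q = A * Q"
      using OA Q S R by (simp add: Q_def[symmetric] mult_mat_assoc D OD)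
    then have "mat_adjoint (Q * A * Q) = mat_adjoint (A * Q)" by simp
    then have "Q * (A * Q) = Q * A"
      using OA Q by (simp add: mat_adjoint_mult Qadj D OD mult_mat_assoc)
    with e show ?thesis using OA Q by (simp add: mult_mat_assoc D OD)
  qed
  show ?thesis
  proof (rule that[of R])
    show "mat_adjoint R * R * A0 = A0 * (mat_adjoint R * R)"
      unfolding S_def[symmetric] Q_def[symmetric]
      using h Q by (intro comm A0) (simp add: A0h mult_mat_vec[of _ d d] Qh)
    show "mat_adjoint R * R * A1 = A1 * (mat_adjoint R * R)"
      unfolding S_def[symmetric] Q_def[symmetric]
    proof (intro comm A1)
      fix a :: nat
      show "Q *\<^sub>v (A1 *\<^sub>v h a) = A1 *\<^sub>v h a"
        using O Q u z by (simp add: h_def mult_add_distrib_mat_vec[of _ d d] mult_mat_vec[of _ d d] A1u A1z Qu Qz)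
    qed
    show "(mat_adjoint R * R) *\<^sub>v u = u" using Qu by (simp add: Q_def S_def)
    \<comment> \<open>\<open>T\<close> kills \<open>u\<close> and, commuting with \<open>A0\<close>,
      also \<open>z\<close>. Hence it kills both vectors \<open>h a\<close>, whose multiples are the
      columns of \<open>S\<close>.\<close>
    fix T assume P: "T \<in> carrier_mat d d" "T * A0 = A0 * T" "T *\<^sub>v u = 0\<^sub>v d"
    have "T *\<^sub>v z = (T * A0) *\<^sub>v u"
      unfolding z_def using P(1) O u by (intro mult_mat_vec_assoc[symmetric]) auto
    also have "\<dots> = A0 *\<^sub>v (T *\<^sub>v u)"
      unfolding P(2) using P(1) O u by (intro mult_mat_vec_assoc) auto
    also have "\<dots> = 0\<^sub>v d" using P O by auto
    finally have Pz: "T *\<^sub>v z = 0\<^sub>v d" .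
    have zero: "k \<cdot>\<^sub>v 0\<^sub>v d = 0\<^sub>v d" for k :: complex by auto
    have "T *\<^sub>v h a = 0\<^sub>v d" for a
      using P u z by (simp add: h_def mult_add_distrib_mat_vec[of _ d d] mult_mat_vec[of _ d d] Pz zero)
    then have "T *\<^sub>v col S a = 0\<^sub>v d" if "a < 2" for a
      using that P h by (simp add: colS mult_mat_vec[of _ d d] zero)
    then show "T * mat_adjoint R = 0\<^sub>m d 2"
      unfolding S_def[symmetric] using P S
      by (intro mat_col_eqI) (simp_all only: col_mult2[OF P(1) S] index_mult_mat index_zero_mat col_zero carrier_matD)
  qed (use R RSR in \<open>auto simp: S_def\<close>)
qed

text \<open>\<open>T\<close> is the orthogonal projection onto the part of the space covered so far,
  the sum of the mutually orthogonal projections \<open>mat_adjoint (R i) * R i\<close>. The sum is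
  stated entrywise, which makes \<open>T\<close> the zero matrix of dimension \<open>d\<close> for
  the empty family.\<close>

definition jordan_family ::
  "nat \<Rightarrow> (bool \<Rightarrow> complex mat) \<Rightarrow> nat \<Rightarrow> (nat \<Rightarrow> complex mat) \<Rightarrow> complex mat \<Rightarrow> bool" where
  "jordan_family d A f R T \<longleftrightarrow>
     (\<forall>i<f. R i \<in> carrier_mat 2 d \<and> R i \<noteq> 0\<^sub>m 2 d \<and> R i * mat_adjoint (R i) * R i = R i \<and>
        R i * T = R i \<and>
        (\<forall>x. mat_adjoint (R i) * R i * A x = A x * (mat_adjoint (R i) * R i))) \<and>
     (\<forall>i<f. \<forall>j<f. i \<noteq> j \<longrightarrow> R i * mat_adjoint (R j) = 0\<^sub>m 2 2) \<and>
     T \<in> carrier_mat d d \<and> mat_adjoint T = T \<and> T * T = T \<and> (\<forall>x. T * A x = A x * T) \<and>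
     (\<forall>r<d. \<forall>c<d. T $$ (r, c) = (\<Sum>i<f. (mat_adjoint (R i) * R i) $$ (r, c)))"

lemma jordan_family_0: "(\<And>x. observable d (A x)) \<Longrightarrow> jordan_family d A 0 R (0\<^sub>m d d)"
  using left_mult_zero_mat[of "A _" d d d] right_mult_zero_mat[of "A _" d d d]
  by (auto simp: jordan_family_def observable_def intro: eq_matI)

text \<open>\<open>TQ\<close> says that the new block is orthogonal to everything covered. Each
  \<open>R i\<close> absorbs \<open>T\<close>, so it is orthogonal to \<open>Q\<close> as well, and
  all cross terms in the conditions on the new projection vanish.\<close>

lemma jordan_family_extend:
  fixes A :: "bool \<Rightarrow> complex mat"
  assumes J: "jordan_family d A f R T" and A: "\<And>x. observable d (A x)"
    and Q: "Q \<in> carrier_mat 2 d" "Q \<noteq> 0\<^sub>m 2 d" "Q * mat_adjoint Q * Q = Q"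
    and comm: "\<And>x. mat_adjoint Q * Q * A x = A x * (mat_adjoint Q * Q)"
    and TQ: "T * mat_adjoint Q = 0\<^sub>m d 2"
  shows "jordan_family d A (Suc f) (R(f := Q)) (T + mat_adjoint Q * Q)"
proof -
  have R: "\<And>i. i < f \<Longrightarrow> R i \<in> carrier_mat 2 d" "\<And>i. i < f \<Longrightarrow> R i \<noteq> 0\<^sub>m 2 d"
    "\<And>i. i < f \<Longrightarrow> R i * mat_adjoint (R i) * R i = R i" "\<And>i. i < f \<Longrightarrow> R i * T = R i"
    "\<And>i x. i < f \<Longrightarrow> mat_adjoint (R i) * R i * A x = A x * (mat_adjoint (R i) * R i)"
    "\<And>i j. i < f \<Longrightarrow> j < f \<Longrightarrow> i \<noteq> j \<Longrightarrow> R i * mat_adjoint (R j) = 0\<^sub>m 2 2"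
    and T: "T \<in> carrier_mat d d" "mat_adjoint T = T" "T * T = T" "\<And>x. T * A x = A x * T"
    "\<And>r c. r < d \<Longrightarrow> c < d \<Longrightarrow> T $$ (r, c) = (\<Sum>i<f. (mat_adjoint (R i) * R i) $$ (r, c))"
    using J unfolding jordan_family_def by blast+
  define S where "S = mat_adjoint Q"
  define E where "E = S * Q"
  have S: "S \<in> carrier_mat d 2" and E: "E \<in> carrier_mat d d"
    using Q by (auto simp: S_def E_def)
  note D = carrier_matD[OF Q(1)] carrier_matD[OF S] carrier_matD[OF T(1)] carrier_matD[OF E]
    carrier_matD[OF R(1)] carrier_matD[OF observableD(1)[OF A]]
  have QT: "Q * T = 0\<^sub>m 2 d"
  proof -
    have "mat_adjoint (T * mat_adjoint Q) = Q * T" by (simp add: mat_adjoint_mult D T)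
    then show ?thesis using TQ by (simp add: zero_mat_adjoint)
  qed
  have TE: "T * E = 0\<^sub>m d d"
  proof -
    have "T * E = T * S * Q" by (simp add: E_def mult_mat_assoc D)
    then show ?thesis using Q(1) by (simp add: TQ S_def)
  qed
  have ET: "E * T = 0\<^sub>m d d"
  proof -
    have "E * T = S * (Q * T)" by (simp add: E_def mult_mat_assoc D)
    then show ?thesis using S by (simp add: QT)
  qed
  have QE: "Q * E = Q"
  proof -
    have "Q * E = Q * S * Q" by (simp add: E_def mult_mat_assoc D)
    then show ?thesis using Q(3) by (simp add: S_def)
  qed
  have EE: "E * E = E"
  proof -
    have "E * E = S * (Q * E)" by (simp add: E_def mult_mat_assoc D)
    then show ?thesis unfolding QE by (simp only: E_def)
  qed
  have RS: "R i * S = 0\<^sub>m 2 2" if "i < f" for i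
  proof -
    have "R i * S = R i * T * S" using that by (simp add: R(4))
    also have "\<dots> = R i * (T * S)" using that by (simp add: mult_mat_assoc D)
    also have "\<dots> = 0\<^sub>m 2 2" unfolding S_def TQ using R(1)[OF that] by simp
    finally show ?thesis .
  qed
  have SR: "Q * mat_adjoint (R i) = 0\<^sub>m 2 2" if "i < f" for i
  proof -
    have "mat_adjoint (R i * S) = Q * mat_adjoint (R i)" using that by (simp add: mat_adjoint_mult D S_def)
    then show ?thesis using RS[OF that] by (simp add: zero_mat_adjoint)
  qed
  have RE: "R i * E = 0\<^sub>m 2 d" if "i < f" for i
  proof -
    have "R i * E = R i * S * Q" using that by (simp add: E_def mult_mat_assoc D)
    then show ?thesis using Q(1) that by (simp add: RS)
  qed
  have Tc: "T + E \<in> carrier_mat d d" using T E by auto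
  have "R i * (T + E) = R i" if "i < f" for i
    using that R(1)[OF that] by (simp add: mult_mat_distrib D R RE)
  moreover have "Q * (T + E) = Q"
    using Q by (simp add: mult_mat_distrib D QT QE)
  moreover have "mat_adjoint (T + E) = T + E"
    by (simp add: mat_adjoint_add mat_adjoint_mult T D E_def S_def)
  moreover have "(T + E) * (T + E) = T + E"
    using T E by (simp add: mult_mat_distrib D T TE ET EE)
  moreover have "(T + E) * A x = A x * (T + E)" for x
    using comm[of x] T(4)[of x] by (simp add: mult_mat_distrib D E_def S_def)
  moreover have "(T + E) $$ (r, c) = (\<Sum>i<Suc f. (mat_adjoint ((R(f := Q)) i) * (R(f := Q)) i) $$ (r, c))"
    if "r < d" "c < d" for r c
  proof -
    have "(T + E) $$ (r, c) = T $$ (r, c) + E $$ (r, c)" using that E by simp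
    also have "T $$ (r, c) = (\<Sum>i<f. (mat_adjoint ((R(f := Q)) i) * (R(f := Q)) i) $$ (r, c))"
      unfolding T(5)[OF that] by (intro sum.cong) auto
    also have "E $$ (r, c) = (mat_adjoint ((R(f := Q)) f) * (R(f := Q)) f) $$ (r, c)" by (simp add: E_def S_def)
    finally show ?thesis by (simp only: sum.lessThan_Suc)
  qed
  ultimately show ?thesis
    using R(1-6) T(1) Q comm RS SR Tc unfolding jordan_family_def S_def[symmetric] E_def[symmetric]
    by (auto simp: less_Suc_eq S_def[symmetric] E_def[symmetric])
qed

text \<open>Column \<open>k\<close> of \<open>M * P = P * B\<close> writes the image of the
  \<open>k\<close>-th column of \<open>P\<close> under \<open>M\<close> as a combination of columns
  0 to \<open>k\<close>. \<open>E\<close> commutes with \<open>M\<close> and kills all of these but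
  the last, so only the diagonal coefficient survives.\<close>

lemma unitriangular_step:
  fixes M P B :: "complex mat"
  assumes M: "M \<in> carrier_mat d d" and P: "P \<in> carrier_mat d d" and B: "B \<in> carrier_mat d d"
    and MP: "M * P = P * B" and tri: "upper_triangular B" and k: "k < d"
    and E: "E \<in> carrier_mat d d" and ME: "M * E = E * M"
    and zero: "\<And>j. j < k \<Longrightarrow> E *\<^sub>v col P j = 0\<^sub>v d"
  shows "M *\<^sub>v (E *\<^sub>v col P k) = B $$ (k, k) \<cdot>\<^sub>v (E *\<^sub>v col P k)"
proof (rule eq_vecI)
  note D = carrier_matD[OF M] carrier_matD[OF P] carrier_matD[OF B] carrier_matD[OF E]
  fix r assume "r < dim_vec (B $$ (k, k) \<cdot>\<^sub>v (E *\<^sub>v col P k))"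
  then have r: "r < d" using E by simp
  have EP: "(E * P) $$ (i, j) = (E *\<^sub>v col P j) $ i" if "i < d" "j < d" for i j
    using that by (simp add: D)
  have "M *\<^sub>v (E *\<^sub>v col P k) = E *\<^sub>v (M *\<^sub>v col P k)"
    by (simp add: mult_mat_vec_assoc[symmetric] D ME)
  also have "M *\<^sub>v col P k = col (M * P) k"
    by (rule col_mult2[OF M P k, symmetric])
  also have "E *\<^sub>v col (M * P) k = (E * P) *\<^sub>v col B k"
    unfolding MP using k by (simp add: D mult_mat_vec_assoc col_mult2[OF P B])
  finally have "(M *\<^sub>v (E *\<^sub>v col P k)) $ r = ((E * P) *\<^sub>v col B k) $ r" by simp
  also have "\<dots> = (\<Sum>j<d. (E * P) $$ (r, j) * B $$ (j, k))"
    using r k by (subst mult_mat_vec_index) (auto simp: D)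
  also have "\<dots> = (\<Sum>j<d. if j = k then (E * P) $$ (r, k) * B $$ (k, k) else 0)"
  proof (rule sum.cong[OF refl])
    fix j assume "j \<in> {..<d}"
    then have j: "j < d" by simp
    have "(E * P) $$ (r, j) = 0" if "j < k" using EP[OF r j] zero[OF that] r by simp
    moreover have "B $$ (j, k) = 0" if "k < j" using tri that j by (auto simp: D)
    ultimately show "(E * P) $$ (r, j) * B $$ (j, k) = (if j = k then (E * P) $$ (r, k) * B $$ (k, k) else 0)"
      by (cases j k rule: linorder_cases) auto
  qed
  also have "\<dots> = (B $$ (k, k) \<cdot>\<^sub>v (E *\<^sub>v col P k)) $ r"
    using k r EP[OF r k] by (simp add: D)
  finally show "(M *\<^sub>v (E *\<^sub>v col P k)) $ r = (B $$ (k, k) \<cdot>\<^sub>v (E *\<^sub>v col P k)) $ r" .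
qed (use M E in auto)

lemma jordan_family_complete:
  fixes A :: "bool \<Rightarrow> complex mat"
  assumes A: "\<And>x. observable d (A x)"
  obtains f R where "jordan_family d A f R (1\<^sub>m d)"
proof -
  note O = observableD[OF A]
  define M where "M = A False * A True"
  have M: "M \<in> carrier_mat d d" using O(1) by (simp add: M_def mult_carrier_mat[of _ d d])
  \<comment> \<open>Over the complex numbers the characteristic polynomial splits, which is what the
    Schur decomposition asks for.\<close>
  obtain es where es: "char_poly M = (\<Prod>e\<leftarrow>es. [:- e, 1:])"
    using char_poly_factorized[OF M] by auto
  obtain B P P' where "schur_decomposition M es = (B, P, P')" by (metis prod_cases3)
  from schur_decomposition[OF M es this]
  have sim: "similar_mat_wit M B P P'" and tri: "upper_triangular B" by auto
  note W = similar_mat_witD2[OF M sim]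
  have MP: "M * P = P * B"
  proof -
    have "M * P = P * B * (P' * P)" using W by (subst W(3)) (simp add: mult_mat_assoc)
    then show ?thesis using W by simp
  qed
  have "\<exists>f R T. jordan_family d A f R T \<and> (\<forall>j<k. T *\<^sub>v col P j = col P j)" if "k \<le> d" for k
    using that
  proof (induction k)
    case 0
    then show ?case using jordan_family_0[of d A, OF A] by blast
  next
    case (Suc k)
    then have k: "k < d" by simp
    from Suc obtain f R T where J: "jordan_family d A f R T" and fix': "\<And>j. j < k \<Longrightarrow> T *\<^sub>v col P j = col P j"
      by auto
    have T: "T \<in> carrier_mat d d" "T * T = T" "\<And>x. T * A x = A x * T" "mat_adjoint T = T"
      using J by (auto simp: jordan_family_def)
    have colP: "col P j \<in> carrier_vec d" if "j < d" for j using that W by auto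
    \<comment> \<open>\<open>E\<close> projects onto the uncovered part. It commutes with the
      observables, hence with \<open>M\<close>, and kills the earlier columns, so
      \<open>unitriangular_step\<close> applies to \<open>u\<close>.\<close>
    define E where "E = 1\<^sub>m d - T"
    have E: "E \<in> carrier_mat d d" using T by (simp add: E_def minus_carrier_mat)
    have Ev: "E *\<^sub>v v = v - T *\<^sub>v v" if "v \<in> carrier_vec d" for v
      using that T by (simp add: E_def minus_mult_distrib_mat_vec[of _ d d])
    define u where "u = E *\<^sub>v col P k"
    have u: "u \<in> carrier_vec d" unfolding u_def by (rule mult_mat_vec_carrier[OF E colP[OF k]])
    have pk: "col P k = T *\<^sub>v col P k + u"
      unfolding u_def Ev[OF colP[OF k]] using mult_mat_vec_carrier[OF T(1) colP[OF k]] colP[OF k]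
      by (intro eq_vecI) (auto simp: carrier_matD[OF T(1)] carrier_matD[OF W(6)])
    show ?case
    \<comment> \<open>If \<open>u\<close> vanishes, column \<open>k\<close> is already covered and
      the family stays as it is.\<close>
    proof (cases "u = 0\<^sub>v d")
      case True
      then have "T *\<^sub>v col P k = col P k" 
        using pk[symmetric] mult_mat_vec_carrier[OF T(1) colP[OF k]] by simp
      then show ?thesis using J fix' less_Suc_eq by (intro exI[of _ f] exI[of _ R] exI[of _ T]) auto
    next
      case False
      note D = carrier_matD[OF T(1)] carrier_matD[OF M] carrier_matD[OF E] carrier_matD[OF O(1)]
      have AE: "A x * E = E * A x" for x
        using O T by (simp add: E_def mult_mat_distrib D)
      have ME: "M * E = E * M"
      proof -
        have "M * E = A False * (E * A True)" by (simp add: M_def mult_mat_assoc D AE)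
        also have "\<dots> = A False * E * A True" by (simp add: mult_mat_assoc D)
        also have "\<dots> = E * M" unfolding AE by (simp add: M_def mult_mat_assoc D)
        finally show ?thesis .
      qed
      have "E *\<^sub>v col P j = 0\<^sub>v d" if "j < k" for j
        using that k fix'[OF that] colP[of j] by (simp add: Ev)
      then have "M *\<^sub>v u = B $$ (k, k) \<cdot>\<^sub>v u"
        unfolding u_def by (intro unitriangular_step[OF M W(6) W(5) MP tri k E ME])
      then have ev: "A False *\<^sub>v (A True *\<^sub>v u) = B $$ (k, k) \<cdot>\<^sub>v u"
        using u by (simp add: M_def mult_mat_vec_assoc D)
      from invariant_block_exists[OF A A u False ev] obtain Q where
        Q: "Q \<in> carrier_mat 2 d" "Q * mat_adjoint Q * Q = Q"
          "mat_adjoint Q * Q * A False = A False * (mat_adjoint Q * Q)"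
          "mat_adjoint Q * Q * A True = A True * (mat_adjoint Q * Q)"
          "(mat_adjoint Q * Q) *\<^sub>v u = u"
        and QT: "\<And>T. T \<in> carrier_mat d d \<Longrightarrow> T * A False = A False * T \<Longrightarrow> T *\<^sub>v u = 0\<^sub>v d \<Longrightarrow>
          T * mat_adjoint Q = 0\<^sub>m d 2" by metis
      have comm: "mat_adjoint Q * Q * A x = A x * (mat_adjoint Q * Q)" for x
        using Q by (cases x) auto
      have Tc: "T *\<^sub>v col P k \<in> carrier_vec d" using T(1) colP[OF k] by (rule mult_mat_vec_carrier)
      have TT: "T *\<^sub>v (T *\<^sub>v col P k) = T *\<^sub>v col P k"
        using mult_mat_vec_assoc[of T T "col P k"] by (simp add: D T W(6)[THEN carrier_matD(1)])
      have "T *\<^sub>v u = T *\<^sub>v col P k - T *\<^sub>v (T *\<^sub>v col P k)"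
        unfolding u_def Ev[OF colP[OF k]] by (rule mult_minus_distrib_mat_vec[OF T(1) colP[OF k] Tc])
      also have "\<dots> = 0\<^sub>v d" unfolding TT using Tc by simp
      finally have Tu: "T *\<^sub>v u = 0\<^sub>v d" .
      have TQ: "T * mat_adjoint Q = 0\<^sub>m d 2" using T Tu by (intro QT)
      have Q0: "Q \<noteq> 0\<^sub>m 2 d"
      proof
        assume "Q = 0\<^sub>m 2 d"
        then have "u = 0\<^sub>m d d *\<^sub>v u" using Q(5) by (simp add: zero_mat_adjoint)
        also have "0\<^sub>m d d *\<^sub>v u = 0\<^sub>v d" using u by (rule zero_mat_mult_vec)
        finally show False using False by simp
      qed
      define F where "F = mat_adjoint Q * Q"
      have F: "F \<in> carrier_mat d d" using Q(1) by (auto simp: F_def)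
      have QT': "Q * T = 0\<^sub>m 2 d"
      proof -
        have "mat_adjoint (T * mat_adjoint Q) = Q * T" using Q(1) by (simp add: mat_adjoint_mult D T)
        then show ?thesis using TQ by (simp add: zero_mat_adjoint)
      qed
      have FT: "F *\<^sub>v (T *\<^sub>v v) = 0\<^sub>v d" if "v \<in> carrier_vec d" for v
      proof -
        have "F * T = mat_adjoint Q * (Q * T)" using Q(1) by (simp add: F_def mult_mat_assoc D)
        also have "\<dots> = 0\<^sub>m d d" using Q(1) by (simp add: QT')
        finally have "F * T = 0\<^sub>m d d" .
        moreover have "F *\<^sub>v (T *\<^sub>v v) = F * T *\<^sub>v v"
          using that F T by (intro mult_mat_vec_assoc[symmetric]) auto
        ultimately show ?thesis using that by (simp add: zero_mat_mult_vec)
      qed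
      \<comment> \<open>\<open>F\<close> kills the range of \<open>T\<close> and fixes
        \<open>u\<close>. So the earlier columns remain fixed, and column \<open>k\<close>, the sum
        of its covered part and \<open>u\<close>, becomes fixed.\<close>
      have "(T + F) *\<^sub>v col P j = col P j" if "j < Suc k" for j
      proof (cases "j = k")
        case True
        have "(T + F) *\<^sub>v col P k = T *\<^sub>v col P k + F *\<^sub>v col P k"
          using T F colP[OF k] by (simp add: add_mult_distrib_mat_vec[of _ d d])
        also have "F *\<^sub>v col P k = F *\<^sub>v (T *\<^sub>v col P k) + F *\<^sub>v u"
          using T F u colP[OF k] by (subst pk) (simp add: mult_add_distrib_mat_vec[of _ d d])
        also have "\<dots> = u" using FT[OF colP[OF k]] Q(5) u by (simp add: F_def)
        finally show ?thesis using pk[symmetric] True by simp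
      next
        case False
        then have j: "j < k" using that by simp
        have "F *\<^sub>v col P j = 0\<^sub>v d" using FT[of "col P j"] fix'[OF j] colP[of j] j k by simp
        then show ?thesis using T F colP[of j] fix'[OF j] j k by (simp add: add_mult_distrib_mat_vec[of _ d d])
      qed
      moreover have "jordan_family d A (Suc f) (R(f := Q)) (T + F)"
        unfolding F_def using jordan_family_extend[OF J A Q(1) Q0 Q(2) comm TQ] .
      ultimately show ?thesis by blast
    qed
  qed
  from this[of d] obtain f R T where J: "jordan_family d A f R T"
    and TP: "\<And>j. j < d \<Longrightarrow> T *\<^sub>v col P j = col P j" by auto
  have T: "T \<in> carrier_mat d d" using J by (simp add: jordan_family_def)
  \<comment> \<open>Now every column of the invertible matrix \<open>P\<close> is fixed by
    \<open>T\<close>; cancelling \<open>P\<close> leaves the identity.\<close>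
  have "T * P = P" using W(6) TP col_mult2[OF T W(6)]
    by (intro mat_col_eqI) (auto simp: carrier_matD[OF T])
  then have "T * P * P' = P * P'" by simp
  then have "T = 1\<^sub>m d" using T W by (simp add: mult_mat_assoc)
  then show ?thesis using J that by blast
qed

text \<open>\<open>J\<close> is obtained by stacking the \<open>R i\<close>. Completeness of the
  family makes it an isometry, orthogonality of the \<open>R i\<close> makes its range projection
  block diagonal, and the compressed observables are the qubit blocks.\<close>

lemma jordan_identification_exists:
  assumes A: "\<And>x. observable d (A x)"
  shows "\<exists>f J N. jordan_identification d A f J N"
proof -
  obtain f R where F: "jordan_family d A f R (1\<^sub>m d)" using jordan_family_complete[OF A] .
  have R: "\<And>i. i < f \<Longrightarrow> R i \<in> carrier_mat 2 d" "\<And>i. i < f \<Longrightarrow> R i \<noteq> 0\<^sub>m 2 d"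
    "\<And>i. i < f \<Longrightarrow> R i * mat_adjoint (R i) * R i = R i"
    "\<And>i x. i < f \<Longrightarrow> mat_adjoint (R i) * R i * A x = A x * (mat_adjoint (R i) * R i)"
    "\<And>i j. i < f \<Longrightarrow> j < f \<Longrightarrow> i \<noteq> j \<Longrightarrow> R i * mat_adjoint (R j) = 0\<^sub>m 2 2"
    and T: "\<And>r c. r < d \<Longrightarrow> c < d \<Longrightarrow> 1\<^sub>m d $$ (r, c) = (\<Sum>i<f. (mat_adjoint (R i) * R i) $$ (r, c))"
    using F unfolding jordan_family_def by blast+
  define N where "N = (\<lambda>x i. R i * A x * mat_adjoint (R i) + (1\<^sub>m 2 - R i * mat_adjoint (R i)))"
  have N: "observable 2 (N x i)" "N x i * R i = R i * A x" if "i < f" for x i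
    using compressed_observable[OF R(1)[OF that] R(3)[OF that] A R(4)[OF that]] by (simp_all add: N_def)
  note AC = observableD(1)[OF A]
  define J where "J = mat (f * 2) d (\<lambda>(r, c). R (r div 2) $$ (r mod 2, c))"
  have J: "J \<in> carrier_mat (f * 2) d" by (simp add: J_def)
  have Ji: "J $$ (i * 2 + a, c) = R i $$ (a, c)" if "i < f" "a < 2" "c < d" for i a c
    using that pair_less[of i f a 2] by (simp add: J_def)
  have "mat_adjoint J * J = 1\<^sub>m d"
  proof (rule eq_matI)
    fix r c assume "r < dim_row (1\<^sub>m d :: complex mat)" "c < dim_col (1\<^sub>m d :: complex mat)"
    then have rc: "r < d" "c < d" by auto
    have "(mat_adjoint J * J) $$ (r, c) = (\<Sum>q<f * 2. mat_adjoint J $$ (r, q) * J $$ (q, c))"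
      using rc J by (intro mult_mat_index) auto
    also have "\<dots> = (\<Sum>i<f. \<Sum>a<2. mat_adjoint (R i) $$ (r, a) * R i $$ (a, c))"
      unfolding sum_pair using rc J R(1)[THEN carrier_matD(1)] R(1)[THEN carrier_matD(2)]
      by (intro sum.cong refl) (simp add: Ji pair_less)
    also have "\<dots> = (\<Sum>i<f. (mat_adjoint (R i) * R i) $$ (r, c))"
      using rc R(1) by (intro sum.cong refl mult_mat_index[symmetric]) auto
    finally show "(mat_adjoint J * J) $$ (r, c) = 1\<^sub>m d $$ (r, c)" using T rc by simp
  qed (use J in auto)
  moreover have "block_sum f (N x) * J = J * A x" for x
  proof (rule eq_matI)
    fix r c assume "r < dim_row (J * A x)" "c < dim_col (J * A x)"
    then have "r < f * 2" and c: "c < d" using J AC[of x] by auto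
    then obtain i a where r: "r = i * 2 + a" "i < f" "a < 2" by (elim pairE)
    have bs: "block_sum f (N x) \<in> carrier_mat (f * 2) (f * 2)"
      using N(1) by (intro block_sum_carrier) (auto dest: observableD)
    have "(block_sum f (N x) * J) $$ (r, c) = (\<Sum>q<f * 2. block_sum f (N x) $$ (r, q) * J $$ (q, c))"
      using r c J pair_less[OF r(2,3)] by (intro mult_mat_index[OF bs J]) auto
    also have "\<dots> = (\<Sum>i'<f. \<Sum>a'<2. if i' = i then N x i $$ (a, a') * R i $$ (a', c) else 0)"
      unfolding sum_pair using r c
      by (intro sum.cong refl) (auto simp: Ji block_sum_index[OF observableD(1)[OF N(1)]])
    also have "\<dots> = (\<Sum>a'<2. N x i $$ (a, a') * R i $$ (a', c))"
      using r by (subst sum.swap) simp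
    also have "\<dots> = (N x i * R i) $$ (a, c)"
      using r c R(1) by (intro mult_mat_index[OF observableD(1)[OF N(1)], symmetric]) auto
    also have "\<dots> = (\<Sum>l<d. R i $$ (a, l) * A x $$ (l, c))"
      unfolding N(2)[OF r(2)] using r c R(1) AC by (intro mult_mat_index) auto
    also have "\<dots> = (\<Sum>l<d. J $$ (r, l) * A x $$ (l, c))"
      using r by (intro sum.cong refl) (simp add: Ji)
    also have "\<dots> = (J * A x) $$ (r, c)"
      using r c pair_less[OF r(2,3)] by (intro mult_mat_index[OF J AC, symmetric]) auto
    finally show "(block_sum f (N x) * J) $$ (r, c) = (J * A x) $$ (r, c)" .
  qed (use J AC[of x] block_sum_carrier[of f "N x", OF observableD(1)[OF N(1)]] in auto)
  moreover have "J * mat_adjoint J = block_sum f (\<lambda>i. R i * mat_adjoint (R i))"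
  proof (rule block_sum_eqI)
    fix i a i' a' assume i: "i < f" "a < (2::nat)" "i' < f" "a' < (2::nat)"
    have "(J * mat_adjoint J) $$ (i * 2 + a, i' * 2 + a') =
      (\<Sum>l<d. J $$ (i * 2 + a, l) * mat_adjoint J $$ (l, i' * 2 + a'))"
      using i J by (intro mult_mat_index[OF J] pair_less) auto
    also have "\<dots> = (\<Sum>l<d. R i $$ (a, l) * mat_adjoint (R i') $$ (l, a'))"
      using i J R(1)[OF i(3)] by (intro sum.cong refl) (simp add: Ji pair_less)
    also have "\<dots> = (R i * mat_adjoint (R i')) $$ (a, a')"
      using i R(1) by (intro mult_mat_index[symmetric]) auto
    finally show "(J * mat_adjoint J) $$ (i * 2 + a, i' * 2 + a') =
      (if i = i' then (R i * mat_adjoint (R i)) $$ (a, a') else 0)" using i R(5) by auto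
  qed (use J R(1) in \<open>auto intro!: mult_carrier_mat[of _ 2 d]\<close>)
  moreover have "R i * mat_adjoint (R i) \<noteq> 0\<^sub>m 2 2" if "i < f" for i
  proof
    assume "R i * mat_adjoint (R i) = 0\<^sub>m 2 2"
    then have "R i = 0\<^sub>m 2 2 * R i" using R(3)[OF that] by simp
    also have "\<dots> = 0\<^sub>m 2 d" using R(1)[OF that] by simp
    finally show False using R(2)[OF that] by simp
  qed
  moreover have "R i * mat_adjoint (R i) \<in> carrier_mat 2 2" if "i < f" for i
    using R(1)[OF that] by (auto intro!: mult_carrier_mat[of _ 2 d])
  ultimately have "jordan_identification d A f J N"
    using J N(1) unfolding jordan_identification_def
    by (intro conjI allI impI exI[of _ "\<lambda>i. R i * mat_adjoint (R i)"])
  then show ?thesis by blast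
qed

section \<open>Expectation values of Bell operators\<close>

text \<open>An unnormalised mixture of pure states: the weight of \<open>v k\<close> is its squared
  norm. Positivity is automatic, and the reduced state of a purification has this form.\<close>

definition ensemble :: "nat \<Rightarrow> nat \<Rightarrow> (nat \<Rightarrow> complex vec) \<Rightarrow> complex mat" where
  "ensemble d e v = mat d d (\<lambda>(i, j). \<Sum>k<e. v k $ i * cnj (v k $ j))"

definition norm_sq :: "complex vec \<Rightarrow> real" where
  "norm_sq v = Re (v \<bullet>c v)"

lemma ensemble_carrier [simp]: "ensemble d e v \<in> carrier_mat d d"
  by (simp add: ensemble_def)

lemma ensemble_1: "v 0 \<in> carrier_vec d \<Longrightarrow> ensemble d 1 v = proj (v 0)"
  by (rule eq_matI) (auto simp: ensemble_def proj_def)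

text \<open>With the vectors as columns of \<open>W\<close>, the ensemble is \<open>W\<close> times
  its adjoint, and applying \<open>K\<close> to every vector is multiplying \<open>W\<close> by
  \<open>K\<close> from the left.\<close>

lemma ensemble_conjugate:
  assumes K: "K \<in> carrier_mat m d" and v: "\<And>k. v k \<in> carrier_vec d"
  shows "K * ensemble d e v * mat_adjoint K = ensemble m e (\<lambda>k. K *\<^sub>v v k)"
proof -
  define W where "W = (\<lambda>d (v :: nat \<Rightarrow> complex vec). mat d e (\<lambda>(i, k). v k $ i))"
  have W: "W d v \<in> carrier_mat d e" for d v by (simp add: W_def)
  have ens: "ensemble d e v = W d v * mat_adjoint (W d v)" for d v
  proof (rule eq_matI)
    fix i j assume "i < dim_row (W d v * mat_adjoint (W d v))" "j < dim_col (W d v * mat_adjoint (W d v))"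
    then have ij: "i < d" "j < d" using W[of d v] by auto
    have "(W d v * mat_adjoint (W d v)) $$ (i, j) = (\<Sum>k<e. W d v $$ (i, k) * mat_adjoint (W d v) $$ (k, j))"
      using ij W[of d v] by (intro mult_mat_index) auto
    also have "\<dots> = (\<Sum>k<e. v k $ i * cnj (v k $ j))"
      using ij carrier_matD[OF W[of d v]] by (intro sum.cong refl) (simp, simp add: W_def)
    finally show "ensemble d e v $$ (i, j) = (W d v * mat_adjoint (W d v)) $$ (i, j)"
      using ij by (simp add: ensemble_def)
  qed (use W[of d v] in \<open>auto simp: ensemble_def\<close>)
  have KW: "K * W d v = W m (\<lambda>k. K *\<^sub>v v k)"
  proof (rule eq_matI)
    fix i k assume "i < dim_row (W m (\<lambda>k. K *\<^sub>v v k))" "k < dim_col (W m (\<lambda>k. K *\<^sub>v v k))"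
    then have ik: "i < m" "k < e" by (auto simp: W_def)
    then have "(K * W d v) $$ (i, k) = (\<Sum>j<d. K $$ (i, j) * v k $ j)"
      using mult_mat_index[OF K W, of i k v] by (simp add: W_def)
    also have "\<dots> = (K *\<^sub>v v k) $ i"
      using ik K v[of k] by (subst mult_mat_vec_index) auto
    finally show "(K * W d v) $$ (i, k) = W m (\<lambda>k. K *\<^sub>v v k) $$ (i, k)"
      using ik by (simp add: W_def)
  qed (use K in \<open>auto simp: W_def\<close>)
  note D = carrier_matD[OF W] carrier_matD[OF K]
  have "K * ensemble d e v * mat_adjoint K = K * W d v * mat_adjoint (K * W d v)"
    by (simp add: ens mat_adjoint_mult mult_mat_assoc D)
  then show ?thesis by (simp only: KW ens)
qed

lemma trace_ensemble:
  assumes X: "X \<in> carrier_mat d d" and v: "\<And>k. k < e \<Longrightarrow> v k \<in> carrier_vec d"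
  shows "mat_trace (ensemble d e v * X) = (\<Sum>k<e. (X *\<^sub>v v k) \<bullet>c v k)"
proof -
  have "mat_trace (ensemble d e v * X) = (\<Sum>i<d. (ensemble d e v * X) $$ (i, i))"
    by (simp add: mat_trace_def ensemble_def)
  also have "\<dots> = (\<Sum>i<d. \<Sum>j<d. \<Sum>k<e. v k $ i * cnj (v k $ j) * X $$ (j, i))"
    using mult_mat_index[OF ensemble_carrier X, of _ _ e v]
    by (intro sum.cong refl) (simp add: ensemble_def sum_distrib_right)
  also have "\<dots> = (\<Sum>j<d. \<Sum>i<d. \<Sum>k<e. v k $ i * cnj (v k $ j) * X $$ (j, i))"
    by (rule sum.swap)
  also have "\<dots> = (\<Sum>j<d. \<Sum>k<e. \<Sum>i<d. v k $ i * cnj (v k $ j) * X $$ (j, i))"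
    by (intro sum.cong refl sum.swap)
  also have "\<dots> = (\<Sum>k<e. \<Sum>j<d. \<Sum>i<d. v k $ i * cnj (v k $ j) * X $$ (j, i))"
    by (rule sum.swap)
  also have "\<dots> = (\<Sum>k<e. (X *\<^sub>v v k) \<bullet>c v k)"
  proof (intro sum.cong refl)
    fix k assume "k \<in> {..<e}"
    then have vk: "v k \<in> carrier_vec d" using v by simp
    have "(X *\<^sub>v v k) \<bullet>c v k = (\<Sum>j<d. (\<Sum>i<d. X $$ (j, i) * v k $ i) * cnj (v k $ j))"
      using X vk by (simp add: cscalar_prod_sum mult_mat_vec_index del: index_mult_mat_vec)
    then show "(\<Sum>j<d. \<Sum>i<d. v k $ i * cnj (v k $ j) * X $$ (j, i)) = (X *\<^sub>v v k) \<bullet>c v k"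
      by (simp add: sum_distrib_left sum_distrib_right mult_ac)
  qed
  finally show ?thesis .
qed

lemma density_ensemble:
  assumes v: "\<And>k. k < e \<Longrightarrow> v k \<in> carrier_vec d" and n: "(\<Sum>k<e. v k \<bullet>c v k) = 1"
  shows "density d (ensemble d e v)"
proof -
  have "mat_adjoint (ensemble d e v) = ensemble d e v"
    by (rule eq_matI) (auto simp: ensemble_def mult.commute)
  moreover have "mat_trace (ensemble d e v) = 1"
  proof -
    have "mat_trace (ensemble d e v) = mat_trace (ensemble d e v * 1\<^sub>m d)"
      by (simp add: right_mult_one_mat[OF ensemble_carrier])
    also have "\<dots> = (\<Sum>k<e. v k \<bullet>c v k)"
      using v by (subst trace_ensemble) auto
    finally show ?thesis by (simp add: n)
  qed
  \<comment> \<open>The quadratic form at \<open>w\<close> is the sum of the squared moduli of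
    \<open>v k \<bullet>c w\<close>.\<close>
  moreover have "0 \<le> Re ((ensemble d e v *\<^sub>v w) \<bullet>c w)" if w: "w \<in> carrier_vec d" for w
  proof -
    have "(ensemble d e v *\<^sub>v w) \<bullet>c w = (\<Sum>i<d. \<Sum>j<d. \<Sum>k<e. v k $ i * cnj (v k $ j) * w $ j * cnj (w $ i))"
      using w by (simp add: cscalar_prod_sum mult_mat_vec_index ensemble_def sum_distrib_right del: index_mult_mat_vec)
    also have "\<dots> = (\<Sum>i<d. \<Sum>k<e. \<Sum>j<d. v k $ i * cnj (v k $ j) * w $ j * cnj (w $ i))"
      by (intro sum.cong refl sum.swap)
    also have "\<dots> = (\<Sum>k<e. \<Sum>i<d. \<Sum>j<d. v k $ i * cnj (v k $ j) * w $ j * cnj (w $ i))"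
      by (rule sum.swap)
    also have "\<dots> = (\<Sum>k<e. (v k \<bullet>c w) * cnj (v k \<bullet>c w))"
      using w v by (intro sum.cong refl) (simp add: cscalar_prod_sum sum_product, simp add: mult_ac)
    also have "\<dots> = complex_of_real (\<Sum>k<e. (cmod (v k \<bullet>c w))\<^sup>2)"
      by (simp only: of_real_sum complex_norm_square)
    finally show ?thesis by (simp add: sum_nonneg)
  qed
  ultimately show ?thesis by (simp add: density_def hermitian_def)
qed

text \<open>\<open>None\<close> acts as a third input whose observable is the identity, so that the
  nine terms of a Bell operator become one double sum.\<close>

definition ext_obs :: "nat \<Rightarrow> (bool \<Rightarrow> complex mat) \<Rightarrow> bool option \<Rightarrow> complex mat" where
  "ext_obs d A s = (case s of None \<Rightarrow> 1\<^sub>m d | Some x \<Rightarrow> A x)"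

definition bell_coeff :: "bell \<Rightarrow> bool option \<Rightarrow> bool option \<Rightarrow> real" where
  "bell_coeff b s t = (case (s, t) of (None, None) \<Rightarrow> coeff_id b | (Some x, None) \<Rightarrow> coeff_A b x
     | (None, Some y) \<Rightarrow> coeff_B b y | (Some x, Some y) \<Rightarrow> coeff_AB b x y)"

lemma ext_obs_carrier: "(\<And>x. A x \<in> carrier_mat d d) \<Longrightarrow> ext_obs d A s \<in> carrier_mat d d"
  by (auto simp: ext_obs_def split: option.split)

lemma sum_bool_option: "(\<Sum>s\<in>UNIV. g s) = g None + (g (Some False) + g (Some True))"
  for g :: "bool option \<Rightarrow> 'a::comm_monoid_add"
  by (simp add: UNIV_option_conv UNIV_bool)

lemma bell_operator_carrier:
  assumes "\<And>x. A x \<in> carrier_mat dA dA" "\<And>y. B y \<in> carrier_mat dB dB"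
  shows "bell_operator b dA dB A B \<in> carrier_mat (dA * dB) (dA * dB)"
  unfolding bell_operator_def using assms
  by (intro add_carrier_mat smult_carrier_mat kron_carrier one_carrier_mat)

lemma bell_operator_index:
  assumes A: "\<And>x. A x \<in> carrier_mat dA dA" and B: "\<And>y. B y \<in> carrier_mat dB dB"
    and rc: "r < dA * dB" "c < dA * dB"
  shows "bell_operator b dA dB A B $$ (r, c) =
    (\<Sum>s\<in>UNIV. \<Sum>t\<in>UNIV. bell_coeff b s t * (ext_obs dA A s \<otimes>\<^sub>k ext_obs dB B t) $$ (r, c))"
  \<comment> \<open>The constant term is read as a Kronecker product of two identities, to match the
    pair of inputs \<open>None\<close>, \<open>None\<close>.\<close>
  using rc by (simp add: bell_operator_def bell_coeff_def ext_obs_def sum_bool_option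
    carrier_matD[OF A] carrier_matD[OF B] del: kron_one flip: kron_one)

text \<open>Reduces claims about Bell values to single products of observables, on which isometries
  and block sums act transparently.\<close>

lemma bell_operator_cscalar:
  assumes A: "\<And>x. A x \<in> carrier_mat dA dA" and B: "\<And>y. B y \<in> carrier_mat dB dB"
    and v: "v \<in> carrier_vec (dA * dB)" and w: "w \<in> carrier_vec (dA * dB)"
  shows "(bell_operator b dA dB A B *\<^sub>v v) \<bullet>c w =
    (\<Sum>s\<in>UNIV. \<Sum>t\<in>UNIV. bell_coeff b s t * (((ext_obs dA A s \<otimes>\<^sub>k ext_obs dB B t) *\<^sub>v v) \<bullet>c w))"
proof -
  define d where "d = dA * dB"
  define Z where "Z = (\<lambda>s t. ext_obs dA A s \<otimes>\<^sub>k ext_obs dB B t)"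
  have Z: "Z s t \<in> carrier_mat d d" for s t
    unfolding Z_def d_def by (intro kron_carrier ext_obs_carrier A B)
  have q: "(X *\<^sub>v v) \<bullet>c w = (\<Sum>r<d. \<Sum>c<d. X $$ (r, c) * (v $ c * cnj (w $ r)))" if "X \<in> carrier_mat d d" for X
    using that v w
    by (simp add: cscalar_prod_sum mult_mat_vec_index d_def[symmetric] sum_distrib_right mult.assoc del: index_mult_mat_vec)
  have "(bell_operator b dA dB A B *\<^sub>v v) \<bullet>c w =
    (\<Sum>r<d. \<Sum>c<d. \<Sum>s\<in>UNIV. \<Sum>t\<in>UNIV. bell_coeff b s t * (Z s t $$ (r, c) * (v $ c * cnj (w $ r))))"
    using q[OF bell_operator_carrier[where A=A and B=B and dA=dA and dB=dB and b=b, folded d_def, OF A B]]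
    by (simp add: bell_operator_index[OF A B] d_def[symmetric] Z_def sum_distrib_right mult.assoc)
  also have "\<dots> = (\<Sum>r<d. \<Sum>s\<in>UNIV. \<Sum>c<d. \<Sum>t\<in>UNIV. bell_coeff b s t * (Z s t $$ (r, c) * (v $ c * cnj (w $ r))))"
    by (intro sum.cong refl sum.swap)
  also have "\<dots> = (\<Sum>s\<in>UNIV. \<Sum>r<d. \<Sum>c<d. \<Sum>t\<in>UNIV. bell_coeff b s t * (Z s t $$ (r, c) * (v $ c * cnj (w $ r))))"
    by (rule sum.swap)
  also have "\<dots> = (\<Sum>s\<in>UNIV. \<Sum>r<d. \<Sum>t\<in>UNIV. \<Sum>c<d. bell_coeff b s t * (Z s t $$ (r, c) * (v $ c * cnj (w $ r))))"
    by (intro sum.cong refl sum.swap)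
  also have "\<dots> = (\<Sum>s\<in>UNIV. \<Sum>t\<in>UNIV. \<Sum>r<d. \<Sum>c<d. bell_coeff b s t * (Z s t $$ (r, c) * (v $ c * cnj (w $ r))))"
    by (intro sum.cong refl sum.swap)
  also have "\<dots> = (\<Sum>s\<in>UNIV. \<Sum>t\<in>UNIV. bell_coeff b s t * ((Z s t *\<^sub>v v) \<bullet>c w))"
    by (simp add: q[OF Z] sum_distrib_left)
  finally show ?thesis by (simp add: Z_def)
qed

text \<open>Defined for vectors of any norm, so that the values of the pieces of a state can be
  added without renormalising them.\<close>

definition bell_exp :: "bell \<Rightarrow> nat \<Rightarrow> nat \<Rightarrow> (bool \<Rightarrow> complex mat) \<Rightarrow> (bool \<Rightarrow> complex mat) \<Rightarrow> complex vec \<Rightarrow> real" where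
  "bell_exp b dA dB A B v = Re ((bell_operator b dA dB A B *\<^sub>v v) \<bullet>c v)"

lemma bell_value_ensemble:
  assumes "\<And>x. A x \<in> carrier_mat dA dA" "\<And>y. B y \<in> carrier_mat dB dB"
    "\<And>k. k < e \<Longrightarrow> v k \<in> carrier_vec (dA * dB)"
  shows "bell_value b dA dB (ensemble (dA * dB) e v) A B = (\<Sum>k<e. bell_exp b dA dB A B (v k))"
  unfolding bell_value_def bell_exp_def using assms
  by (subst trace_ensemble) (auto intro: bell_operator_carrier)

lemma isometry_kron:
  assumes "K \<in> carrier_mat m dA" "mat_adjoint K * K = 1\<^sub>m dA" "L \<in> carrier_mat n dB" "mat_adjoint L * L = 1\<^sub>m dB"
  shows "mat_adjoint (K \<otimes>\<^sub>k L) * (K \<otimes>\<^sub>k L) = 1\<^sub>m (dA * dB)"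
  using assms by (simp add: mat_adjoint_kron kron_mult[of _ dA m _ dB n _ dA _ dB])

lemma norm_sq_isometry:
  assumes "K \<in> carrier_mat m d" "mat_adjoint K * K = 1\<^sub>m d" "v \<in> carrier_vec d"
  shows "norm_sq (K *\<^sub>v v) = norm_sq v"
  using assms by (simp add: norm_sq_def isometry_cscalar_prod)

text \<open>The intertwining relations extend to the identity, so
  \<open>K \<otimes>\<^sub>k L\<close> intertwines every term of the Bell operator, and as an
  isometry it preserves inner products. It serves both for the embeddings \<open>JA\<close>,
  \<open>JB\<close> and for the rotations of a block.\<close>

lemma bell_exp_isometry:
  assumes A: "\<And>x. A x \<in> carrier_mat dA dA" and B: "\<And>y. B y \<in> carrier_mat dB dB"
    and A': "\<And>x. A' x \<in> carrier_mat m m" and B': "\<And>y. B' y \<in> carrier_mat n n"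
    and K: "K \<in> carrier_mat m dA" "mat_adjoint K * K = 1\<^sub>m dA" "\<And>x. A' x * K = K * A x"
    and L: "L \<in> carrier_mat n dB" "mat_adjoint L * L = 1\<^sub>m dB" "\<And>y. B' y * L = L * B y"
    and v: "v \<in> carrier_vec (dA * dB)"
  shows "bell_exp b m n A' B' ((K \<otimes>\<^sub>k L) *\<^sub>v v) = bell_exp b dA dB A B v"
proof -
  have KL: "K \<otimes>\<^sub>k L \<in> carrier_mat (m * n) (dA * dB)" using K L by auto
  have KLv: "(K \<otimes>\<^sub>k L) *\<^sub>v v \<in> carrier_vec (m * n)" using KL v by (rule mult_mat_vec_carrier)
  have "((ext_obs m A' s \<otimes>\<^sub>k ext_obs n B' t) *\<^sub>v ((K \<otimes>\<^sub>k L) *\<^sub>v v)) \<bullet>c ((K \<otimes>\<^sub>k L) *\<^sub>v v) =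
    ((ext_obs dA A s \<otimes>\<^sub>k ext_obs dB B t) *\<^sub>v v) \<bullet>c v" for s t
  proof -
    have e: "ext_obs m A' s \<in> carrier_mat m m" "ext_obs n B' t \<in> carrier_mat n n"
      "ext_obs dA A s \<in> carrier_mat dA dA" "ext_obs dB B t \<in> carrier_mat dB dB"
      using A B A' B' by (auto intro: ext_obs_carrier)
    have i: "ext_obs m A' s * K = K * ext_obs dA A s" "ext_obs n B' t * L = L * ext_obs dB B t"
      using K L by (auto simp: ext_obs_def split: option.split)
    have EE: "ext_obs dA A s \<otimes>\<^sub>k ext_obs dB B t \<in> carrier_mat (dA * dB) (dA * dB)" using e by auto
    have "(ext_obs m A' s \<otimes>\<^sub>k ext_obs n B' t) *\<^sub>v ((K \<otimes>\<^sub>k L) *\<^sub>v v) =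
      ((ext_obs m A' s \<otimes>\<^sub>k ext_obs n B' t) * (K \<otimes>\<^sub>k L)) *\<^sub>v v"
      using e K(1) L(1) v by (subst mult_mat_vec_assoc) auto
    also have "\<dots> = ((K \<otimes>\<^sub>k L) * (ext_obs dA A s \<otimes>\<^sub>k ext_obs dB B t)) *\<^sub>v v"
      by (simp only: kron_mult[OF e(1,2) K(1) L(1)] kron_mult[OF K(1) L(1) e(3,4)] i)
    also have "\<dots> = (K \<otimes>\<^sub>k L) *\<^sub>v ((ext_obs dA A s \<otimes>\<^sub>k ext_obs dB B t) *\<^sub>v v)"
      using e K(1) L(1) v by (subst mult_mat_vec_assoc) auto
    finally show ?thesis
      using isometry_cscalar_prod[OF KL isometry_kron[OF K(1,2) L(1,2)] mult_mat_vec_carrier[OF EE v] v] by simp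
  qed
  then show ?thesis
    unfolding bell_exp_def bell_operator_cscalar[OF A' B' KLv KLv] bell_operator_cscalar[OF A B v v] by simp
qed

lemma bell_exp_smult:
  assumes A: "\<And>x. A x \<in> carrier_mat dA dA" and B: "\<And>y. B y \<in> carrier_mat dB dB"
    and v: "v \<in> carrier_vec (dA * dB)"
  shows "bell_exp b dA dB A B (c \<cdot>\<^sub>v v) = (cmod c)\<^sup>2 * bell_exp b dA dB A B v"
proof -
  define Z where "Z = bell_operator b dA dB A B"
  have Z: "Z \<in> carrier_mat (dA * dB) (dA * dB)" unfolding Z_def by (rule bell_operator_carrier[OF A B])
  have Zv: "Z *\<^sub>v v \<in> carrier_vec (dA * dB)" using Z v by (rule mult_mat_vec_carrier)
  have "(Z *\<^sub>v (c \<cdot>\<^sub>v v)) \<bullet>c (c \<cdot>\<^sub>v v) = (c * cnj c) * ((Z *\<^sub>v v) \<bullet>c v)"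
    using mult_mat_vec[OF Z v, of c] cscalar_prod_smult_left[OF Zv, of "c \<cdot>\<^sub>v v" c]
      cscalar_prod_smult_right[OF Zv v, of c] v by simp
  also have "c * cnj c = complex_of_real ((cmod c)\<^sup>2)" by (simp only: complex_norm_square)
  finally show ?thesis by (simp add: bell_exp_def Z_def)
qed

section \<open>Norms, normalisation and parallel vectors\<close>

lemma norm_sq_smult: "norm_sq (c \<cdot>\<^sub>v v) = (cmod c)\<^sup>2 * norm_sq v"
  by (simp add: norm_sq_def cscalar_prod_self norm_mult power_mult_distrib sum_distrib_left)

lemma cscalar_prod_norm_sq: "v \<bullet>c v = complex_of_real (norm_sq v)"
  by (simp add: norm_sq_def cscalar_prod_self)

lemma norm_sq_pos: "v \<in> carrier_vec n \<Longrightarrow> v \<noteq> 0\<^sub>v n \<Longrightarrow> norm_sq v > 0"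
proof -
  assume v: "v \<in> carrier_vec n" "v \<noteq> 0\<^sub>v n"
  have "norm_sq v \<noteq> 0" using v conjugate_square_eq_0_vec[OF v(1)] by (simp add: cscalar_prod_norm_sq)
  moreover have "norm_sq v \<ge> 0" by (simp add: norm_sq_def cscalar_prod_self sum_nonneg)
  ultimately show ?thesis by simp
qed

lemma normalise:
  assumes v: "v \<in> carrier_vec n" "v \<noteq> 0\<^sub>v n"
  obtains c where "c > 0" "c * c * norm_sq v = 1" 
    "complex_of_real c \<cdot>\<^sub>v v \<in> carrier_vec n" "norm_sq (complex_of_real c \<cdot>\<^sub>v v) = 1"
proof -
  define c where "c = 1 / sqrt (norm_sq v)"
  have p: "norm_sq v > 0" using norm_sq_pos[OF v] .
  have "c > 0" using p by (simp add: c_def)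
  moreover have cc: "c * c * norm_sq v = 1" using p by (simp add: c_def)
  ultimately show ?thesis using that[of c] v by (simp add: norm_sq_smult power2_eq_square)
qed

text \<open>Vanishing 2x2 minors make the vectors parallel. Multiplying an entry of \<open>u\<close>
  by \<open>w \<bullet>c w\<close>, which is 1, and exchanging indices by \<open>minors\<close> also
  yields the factor.\<close>

lemma proportional:
  fixes u w :: "complex vec"
  assumes u: "u \<in> carrier_vec n" and w: "w \<in> carrier_vec n" "w \<bullet>c w = 1"
    and minors: "\<And>r s. r < n \<Longrightarrow> s < n \<Longrightarrow> u $ r * w $ s = u $ s * w $ r"
  shows "u = (u \<bullet>c w) \<cdot>\<^sub>v w"
proof (rule eq_vecI)
  fix r assume "r < dim_vec ((u \<bullet>c w) \<cdot>\<^sub>v w)"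
  then have r: "r < n" using w by simp
  have "u $ r = u $ r * (\<Sum>s<n. w $ s * cnj (w $ s))" using w by (simp add: cscalar_prod_sum)
  also have "\<dots> = (\<Sum>s<n. u $ s * cnj (w $ s) * w $ r)"
    unfolding sum_distrib_left
  proof (intro sum.cong refl)
    fix s assume "s \<in> {..<n}"
    then have "u $ r * w $ s = u $ s * w $ r" using r minors by simp
    then show "u $ r * (w $ s * cnj (w $ s)) = u $ s * cnj (w $ s) * w $ r"
      by (metis mult.assoc mult.commute)
  qed
  also have "\<dots> = ((u \<bullet>c w) \<cdot>\<^sub>v w) $ r" using w r by (simp add: cscalar_prod_sum sum_distrib_right)
  finally show "u $ r = ((u \<bullet>c w) \<cdot>\<^sub>v w) $ r" .
qed (use u w in auto)

text \<open>The assumptions are the entries of a 2x2 matrix that is a sum of two rank-one matrices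
  and also equal to a single one. By Lagrange's identity its determinant is the squared modulus of
  the minor, and by rank one it vanishes.\<close>

lemma minors_of_rank_one:
  fixes x1 y1 x2 y2 t1 t2 :: complex
  assumes "x1 * cnj x1 + y1 * cnj y1 = t1 * cnj t1" "x1 * cnj x2 + y1 * cnj y2 = t1 * cnj t2"
    "x2 * cnj x1 + y2 * cnj y1 = t2 * cnj t1" "x2 * cnj x2 + y2 * cnj y2 = t2 * cnj t2"
  shows "x1 * y2 = x2 * y1"
proof -
  have "(x1 * y2 - x2 * y1) * cnj (x1 * y2 - x2 * y1) =
    (x1 * cnj x1 + y1 * cnj y1) * (x2 * cnj x2 + y2 * cnj y2) -
    (x1 * cnj x2 + y1 * cnj y2) * (x2 * cnj x1 + y2 * cnj y1)"
    by (simp add: algebra_simps)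
  also have "\<dots> = 0" unfolding assms by (simp add: algebra_simps)
  finally have "x1 * y2 - x2 * y1 = 0" by (metis complex_cnj_zero_iff mult_eq_0_iff)
  then show ?thesis by simp
qed

section \<open>Decomposition into two-qubit blocks\<close>

text \<open>The partial inner product of \<open>v\<close> with the \<open>k\<close>-th basis vector
  of the first tensor factor. The slices of a purification along E form the mixture that is the
  reduced state.\<close>

definition slice :: "nat \<Rightarrow> complex vec \<Rightarrow> nat \<Rightarrow> complex vec" where
  "slice d v k = vec d (\<lambda>i. v $ (k * d + i))"

text \<open>Here \<open>n\<close> is the number of blocks of the second factor.\<close>
definition qubit_block :: "nat \<Rightarrow> complex vec \<Rightarrow> nat \<Rightarrow> nat \<Rightarrow> complex vec" where
  "qubit_block n v i j =
     vec (2 * 2) (\<lambda>r. v $ ((i * 2 + r div 2) * (n * 2) + (j * 2 + r mod 2)))"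

lemma slice_carrier [simp]: "slice d v k \<in> carrier_vec d"
  by (simp add: slice_def)

lemma qubit_block_carrier [simp]: "qubit_block n v i j \<in> carrier_vec (2 * 2)"
  by (simp add: qubit_block_def)

lemma slice_kron_one:
  assumes Z: "Z \<in> carrier_mat m d" and v: "v \<in> carrier_vec (e * d)" and k: "k < e"
  shows "slice m ((1\<^sub>m e \<otimes>\<^sub>k Z) *\<^sub>v v) k = Z *\<^sub>v slice d v k"
proof (rule eq_vecI)
  fix i assume "i < dim_vec (Z *\<^sub>v slice d v k)"
  then have i: "i < m" using Z by simp
  have "slice m ((1\<^sub>m e \<otimes>\<^sub>k Z) *\<^sub>v v) k $ i = ((1\<^sub>m e \<otimes>\<^sub>k Z) *\<^sub>v v) $ (k * m + i)"
    using i by (simp add: slice_def)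
  also have "\<dots> = (\<Sum>k'<e. \<Sum>i'<d. 1\<^sub>m e $$ (k, k') * Z $$ (i, i') * v $ (k' * d + i'))"
    by (rule kron_mult_vec_index[OF one_carrier_mat Z v k i])
  also have "\<dots> = (\<Sum>i'<d. \<Sum>k'<e. 1\<^sub>m e $$ (k, k') * Z $$ (i, i') * v $ (k' * d + i'))"
    by (rule sum.swap)
  also have "\<dots> = (\<Sum>i'<d. \<Sum>k'<e. if k' = k then Z $$ (i, i') * v $ (k * d + i') else 0)"
    using k by (intro sum.cong refl) auto
  also have "\<dots> = (\<Sum>i'<d. Z $$ (i, i') * v $ (k * d + i'))"
    using k by simp
  also have "\<dots> = (Z *\<^sub>v slice d v k) $ i"
    using i Z by (subst mult_mat_vec_index) (auto simp: slice_def)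
  finally show "slice m ((1\<^sub>m e \<otimes>\<^sub>k Z) *\<^sub>v v) k $ i = (Z *\<^sub>v slice d v k) $ i" .
qed (use Z in \<open>auto simp: slice_def\<close>)

lemma norm_sq_index: "norm_sq v = (\<Sum>i<dim_vec v. (cmod (v $ i))\<^sup>2)"
  by (simp add: norm_sq_def cscalar_prod_self)

lemma norm_sq_slices:
  assumes v: "v \<in> carrier_vec (e * d)"
  shows "norm_sq v = (\<Sum>k<e. norm_sq (slice d v k))"
  unfolding norm_sq_index carrier_vecD[OF v] sum_pair by (simp add: slice_def)

lemma qubit_block_index:
  "a < 2 \<Longrightarrow> c < 2 \<Longrightarrow> qubit_block n v i j $ (a * 2 + c) = v $ ((i * 2 + a) * (n * 2) + (j * 2 + c))"
  using pair_less[of a 2 c 2] by (simp add: qubit_block_def)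

lemma sum_qubit_blocks:
  fixes v w :: "complex vec"
  assumes v: "v \<in> carrier_vec ((m * 2) * (n * 2))" and w: "w \<in> carrier_vec ((m * 2) * (n * 2))"
  shows "v \<bullet>c w = (\<Sum>i<m. \<Sum>j<n. qubit_block n v i j \<bullet>c qubit_block n w i j)"
proof -
  have "v \<bullet>c w = (\<Sum>i<m. \<Sum>a<2. \<Sum>j<n. \<Sum>c<2.
      v $ ((i * 2 + a) * (n * 2) + (j * 2 + c)) * cnj (w $ ((i * 2 + a) * (n * 2) + (j * 2 + c))))"
    unfolding cscalar_prod_sum carrier_vecD[OF w] sum_pair ..
  \<comment> \<open>The factors come in the order F_A, Q_A, F_B, Q_B, and a block fixes the first
    and the third, so the two middle sums have to change places.\<close>
  also have "\<dots> = (\<Sum>i<m. \<Sum>j<n. \<Sum>a<2. \<Sum>c<2.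
      v $ ((i * 2 + a) * (n * 2) + (j * 2 + c)) * cnj (w $ ((i * 2 + a) * (n * 2) + (j * 2 + c))))"
    by (intro sum.cong refl sum.swap)
  also have "\<dots> = (\<Sum>i<m. \<Sum>j<n. qubit_block n v i j \<bullet>c qubit_block n w i j)"
    unfolding cscalar_prod_sum carrier_vecD[OF qubit_block_carrier] sum_pair
    by (intro sum.cong refl) (simp add: qubit_block_index)
  finally show ?thesis .
qed

lemma norm_sq_qubit_blocks:
  assumes "v \<in> carrier_vec ((m * 2) * (n * 2))"
  shows "norm_sq v = (\<Sum>i<m. \<Sum>j<n. norm_sq (qubit_block n v i j))"
  unfolding norm_sq_def sum_qubit_blocks[OF assms assms] by simp

lemma qubit_block_mult:
  assumes X: "\<And>i. i < m \<Longrightarrow> X i \<in> carrier_mat 2 2" and Y: "\<And>j. j < n \<Longrightarrow> Y j \<in> carrier_mat 2 2"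
    and v: "v \<in> carrier_vec ((m * 2) * (n * 2))" and ij: "i < m" "j < n"
  shows "qubit_block n ((block_sum m X \<otimes>\<^sub>k block_sum n Y) *\<^sub>v v) i j = (X i \<otimes>\<^sub>k Y j) *\<^sub>v qubit_block n v i j"
proof (rule eq_vecI)
  note XY = X[OF ij(1)] Y[OF ij(2)]
  fix r assume "r < dim_vec ((X i \<otimes>\<^sub>k Y j) *\<^sub>v qubit_block n v i j)"
  then have "r < 2 * 2" using XY by simp
  then obtain a c where r: "r = a * 2 + c" "a < 2" "c < 2" by (rule pairE)
  have "qubit_block n ((block_sum m X \<otimes>\<^sub>k block_sum n Y) *\<^sub>v v) i j $ r =
    ((block_sum m X \<otimes>\<^sub>k block_sum n Y) *\<^sub>v v) $ ((i * 2 + a) * (n * 2) + (j * 2 + c))"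
    using r by (simp add: qubit_block_index)
  also have "\<dots> = (\<Sum>p<m * 2. \<Sum>q<n * 2. block_sum m X $$ (i * 2 + a, p) * block_sum n Y $$ (j * 2 + c, q) *
      v $ (p * (n * 2) + q))"
    using r ij by (intro kron_mult_vec_index[OF block_sum_carrier block_sum_carrier v] X Y pair_less)
  \<comment> \<open>Only the diagonal blocks contribute. The two tests are nested so that the sum
    over \<open>j'\<close> can be moved inward and collapsed before the one over
    \<open>i'\<close>.\<close>
  also have "\<dots> = (\<Sum>i'<m. \<Sum>a'<2. \<Sum>j'<n. \<Sum>c'<2. if j' = j then if i' = i then
      X i $$ (a, a') * Y j $$ (c, c') * v $ ((i * 2 + a') * (n * 2) + (j * 2 + c')) else 0 else 0)"
    unfolding sum_pair using r ij by (intro sum.cong refl) (auto simp: block_sum_index X Y)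
  also have "\<dots> = (\<Sum>i'<m. \<Sum>a'<2. \<Sum>c'<2. \<Sum>j'<n. if j' = j then if i' = i then
      X i $$ (a, a') * Y j $$ (c, c') * v $ ((i * 2 + a') * (n * 2) + (j * 2 + c')) else 0 else 0)"
    by (intro sum.cong refl sum.swap)
  also have "\<dots> = (\<Sum>i'<m. \<Sum>a'<2. \<Sum>c'<2. if i' = i then
      X i $$ (a, a') * Y j $$ (c, c') * v $ ((i * 2 + a') * (n * 2) + (j * 2 + c')) else 0)"
    using ij by simp
  also have "\<dots> = (\<Sum>i'<m. if i' = i then \<Sum>a'<2. \<Sum>c'<2.
      X i $$ (a, a') * Y j $$ (c, c') * v $ ((i * 2 + a') * (n * 2) + (j * 2 + c')) else 0)"
    by (intro sum.cong refl) simp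
  also have "\<dots> = (\<Sum>a'<2. \<Sum>c'<2. X i $$ (a, a') * Y j $$ (c, c') * qubit_block n v i j $ (a' * 2 + c'))"
    using ij by (simp add: qubit_block_index)
  also have "\<dots> = ((X i \<otimes>\<^sub>k Y j) *\<^sub>v qubit_block n v i j) $ r"
    unfolding r(1) using r by (intro kron_mult_vec_index[OF XY qubit_block_carrier, symmetric])
  finally show "qubit_block n ((block_sum m X \<otimes>\<^sub>k block_sum n Y) *\<^sub>v v) i j $ r =
    ((X i \<otimes>\<^sub>k Y j) *\<^sub>v qubit_block n v i j) $ r" .
qed (use X[OF ij(1)] Y[OF ij(2)] in \<open>auto simp: qubit_block_def\<close>)

text \<open>The identity is a block sum of identities, so adjoining it as a further observable
  commutes with forming block sums. Each product of observables then splits over the pairs of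
  blocks.\<close>

lemma bell_exp_qubit_blocks:
  assumes N: "\<And>x i. i < m \<Longrightarrow> N x i \<in> carrier_mat 2 2" and M: "\<And>y j. j < n \<Longrightarrow> M y j \<in> carrier_mat 2 2"
    and v: "v \<in> carrier_vec ((m * 2) * (n * 2))"
  shows "bell_exp b (m * 2) (n * 2) (\<lambda>x. block_sum m (N x)) (\<lambda>y. block_sum n (M y)) v =
    (\<Sum>i<m. \<Sum>j<n. bell_exp b 2 2 (\<lambda>x. N x i) (\<lambda>y. M y j) (qubit_block n v i j))"
proof -
  define F where "F = (\<lambda>s i. ext_obs 2 (\<lambda>x. N x i) s)"
  define G where "G = (\<lambda>t j. ext_obs 2 (\<lambda>y. M y j) t)"
  have F: "F s i \<in> carrier_mat 2 2" if "i < m" for s i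
    unfolding F_def using N[OF that] by (rule ext_obs_carrier)
  have G: "G t j \<in> carrier_mat 2 2" if "j < n" for t j
    unfolding G_def using M[OF that] by (rule ext_obs_carrier)
  have bF: "ext_obs (m * 2) (\<lambda>x. block_sum m (N x)) s = block_sum m (F s)" for s
    by (auto simp: F_def ext_obs_def block_sum_one split: option.split)
  have bG: "ext_obs (n * 2) (\<lambda>y. block_sum n (M y)) t = block_sum n (G t)" for t
    by (auto simp: G_def ext_obs_def block_sum_one split: option.split)
  have block: "((block_sum m (F s) \<otimes>\<^sub>k block_sum n (G t)) *\<^sub>v v) \<bullet>c v =
    (\<Sum>i<m. \<Sum>j<n. ((F s i \<otimes>\<^sub>k G t j) *\<^sub>v qubit_block n v i j) \<bullet>c qubit_block n v i j)" for s t
  proof -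
    have FG: "block_sum m (F s) \<otimes>\<^sub>k block_sum n (G t) \<in> carrier_mat (m * 2 * (n * 2)) (m * 2 * (n * 2))"
      by (intro kron_carrier block_sum_carrier F G)
    show ?thesis unfolding sum_qubit_blocks[OF mult_mat_vec_carrier[OF FG v] v]
      by (intro sum.cong refl) (simp add: qubit_block_mult[OF F G v])
  qed
  have "(bell_operator b (m * 2) (n * 2) (\<lambda>x. block_sum m (N x)) (\<lambda>y. block_sum n (M y)) *\<^sub>v v) \<bullet>c v =
    (\<Sum>s\<in>UNIV. \<Sum>t\<in>UNIV. \<Sum>i<m. \<Sum>j<n. bell_coeff b s t *
      (((F s i \<otimes>\<^sub>k G t j) *\<^sub>v qubit_block n v i j) \<bullet>c qubit_block n v i j))"
    by (simp add: bell_operator_cscalar[OF block_sum_carrier block_sum_carrier v v, OF N M] bF bG block sum_distrib_left)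
  also have "\<dots> = (\<Sum>s\<in>UNIV. \<Sum>i<m. \<Sum>t\<in>UNIV. \<Sum>j<n. bell_coeff b s t *
      (((F s i \<otimes>\<^sub>k G t j) *\<^sub>v qubit_block n v i j) \<bullet>c qubit_block n v i j))"
    by (intro sum.cong refl sum.swap)
  also have "\<dots> = (\<Sum>i<m. \<Sum>s\<in>UNIV. \<Sum>t\<in>UNIV. \<Sum>j<n. bell_coeff b s t *
      (((F s i \<otimes>\<^sub>k G t j) *\<^sub>v qubit_block n v i j) \<bullet>c qubit_block n v i j))"
    by (rule sum.swap)
  also have "\<dots> = (\<Sum>i<m. \<Sum>s\<in>UNIV. \<Sum>j<n. \<Sum>t\<in>UNIV. bell_coeff b s t *
      (((F s i \<otimes>\<^sub>k G t j) *\<^sub>v qubit_block n v i j) \<bullet>c qubit_block n v i j))"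
    by (intro sum.cong refl sum.swap)
  also have "\<dots> = (\<Sum>i<m. \<Sum>j<n. \<Sum>s\<in>UNIV. \<Sum>t\<in>UNIV. bell_coeff b s t *
      (((F s i \<otimes>\<^sub>k G t j) *\<^sub>v qubit_block n v i j) \<bullet>c qubit_block n v i j))"
    by (intro sum.cong refl sum.swap)
  also have "\<dots> = (\<Sum>i<m. \<Sum>j<n.
      (bell_operator b 2 2 (\<lambda>x. N x i) (\<lambda>y. M y j) *\<^sub>v qubit_block n v i j) \<bullet>c qubit_block n v i j)"
    by (intro sum.cong refl)
      (simp only: bell_operator_cscalar[OF N M qubit_block_carrier qubit_block_carrier] F_def G_def lessThan_iff)
  finally show ?thesis by (simp add: bell_exp_def)
qed

section \<open>Comparing vectors blockwise after reordering the factors\<close>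

lemma vec_eqI_qubit_blocks:
  assumes v: "v \<in> carrier_vec (e * ((m * 2) * (n * 2)))" and w: "w \<in> carrier_vec (e * ((m * 2) * (n * 2)))"
    and eq: "\<And>k i j. k < e \<Longrightarrow> i < m \<Longrightarrow> j < n \<Longrightarrow>
      qubit_block n (slice ((m * 2) * (n * 2)) v k) i j = qubit_block n (slice ((m * 2) * (n * 2)) w k) i j"
  shows "v = w"
proof (rule eq_vecI)
  fix r assume "r < dim_vec w"
  then have "r < e * ((m * 2) * (n * 2))" using w by simp
  then obtain k s where r: "r = k * ((m * 2) * (n * 2)) + s" "k < e" "s < (m * 2) * (n * 2)" by (rule pairE)
  from r(3) obtain p q where s: "s = p * (n * 2) + q" "p < m * 2" "q < n * 2" by (rule pairE)
  from s(2) obtain i a where p: "p = i * 2 + a" "i < m" "a < 2" by (rule pairE)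
  from s(3) obtain j c where q: "q = j * 2 + c" "j < n" "c < 2" by (rule pairE)
  have "u $ r = qubit_block n (slice ((m * 2) * (n * 2)) u k) i j $ (a * 2 + c)" for u
    using r p q s by (simp add: qubit_block_index slice_def)
  then show "v $ r = w $ r" using eq r p q by simp
qed (use v w in auto)

text \<open>In terms of index digits, \<open>reorder\<close> moves (k, i, j, a, c) to (k, i, a, j,
  c). Fixing \<open>k\<close>, \<open>i\<close>, \<open>j\<close> selects one entry of
  \<open>\<xi>\<close>, while \<open>a\<close> and \<open>c\<close> run through
  \<open>\<chi>\<close>.\<close>

lemma reorder_qubit_block:
  assumes xi: "\<xi> \<in> carrier_vec (e * m * n)" and chi: "\<chi> \<in> carrier_vec (2 * 2)"
    and kij: "k < e" "i < m" "j < n"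
  shows "qubit_block n (slice ((m * 2) * (n * 2)) (reorder e m n *\<^sub>v (\<xi> \<otimes>\<^sub>v \<chi>)) k) i j =
    \<xi> $ ((k * m + i) * n + j) \<cdot>\<^sub>v \<chi>"
proof (rule eq_vecI)
  let ?u = "\<xi> \<otimes>\<^sub>v \<chi>"
  have u: "?u \<in> carrier_vec (e * m * n * (2 * 2))" 
  proof (rule carrier_vecI)
    have "dim_vec ?u = dim_vec \<xi> * dim_vec \<chi>" by (simp add: kron_vec_def)
    then show "dim_vec ?u = e * m * n * (2 * 2)" using xi chi by (simp only: carrier_vecD)
  qed
  have ui: "?u $ (p * (2 * 2) + q) = \<xi> $ p * \<chi> $ q" if "p < e * m * n" "q < 2 * 2" for p q
  proof -
    have "dim_vec \<xi> = e * m * n" "dim_vec \<chi> = 2 * 2" using xi chi by auto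
    then show ?thesis
      using that by (simp only: kron_vec_def index_vec pair_less div_mod_pair)
  qed
  \<comment> \<open>The same dimension grouped differently: \<open>reorder\<close> splits off only
    the last qubit as its final factor.\<close>
  have u': "?u \<in> carrier_vec (e * m * (n * 2) * 2)" 
  proof -
    have "e * m * (n * 2) * 2 = e * m * n * (2 * 2)" by simp
    then show ?thesis using u by (simp only:)
  qed
  fix r assume "r < dim_vec (\<xi> $ ((k * m + i) * n + j) \<cdot>\<^sub>v \<chi>)"
  then have "r < 2 * 2" using chi by simp
  then obtain a c where r: "r = a * 2 + c" "a < 2" "c < 2" by (rule pairE)
  have km: "k * m + i < e * m" using kij by (intro pair_less)
  have l1: "(i * 2 + a) * (n * 2) + (j * 2 + c) < (m * 2) * (n * 2)" using kij r by (intro pair_less)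
  have aj: "a * n + j < 2 * n" using kij r by (intro pair_less)
  have S: "swap_mat n 2 \<in> carrier_mat (2 * n) (n * 2)" by (simp add: swap_mat_def)
  have IS: "1\<^sub>m (e * m) \<otimes>\<^sub>k swap_mat n 2 \<in> carrier_mat (e * m * (2 * n)) (e * m * (n * 2))"
    using S by (intro kron_carrier) auto
  \<comment> \<open>Row (a, j) of the swap has its only 1 in column (j, a).\<close>
  have Si: "swap_mat n 2 $$ (a * n + j, s) = (if s = j * 2 + a then 1 else 0)" if "s < n * 2" for s
  proof -
    from that obtain j' a' where s: "s = j' * 2 + a'" "j' < n" "a' < 2" by (rule pairE)
    have "a * n + j = a' * n + j' \<longleftrightarrow> j' * 2 + a' = j * 2 + a"
      using kij r s by (metis div_mod_pair)
    then show ?thesis using that aj s by (simp add: swap_mat_def)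
  qed
  have "qubit_block n (slice ((m * 2) * (n * 2)) (reorder e m n *\<^sub>v ?u) k) i j $ r =
    (reorder e m n *\<^sub>v ?u) $ (((k * m + i) * (2 * n) + (a * n + j)) * 2 + c)"
  proof -
    have "k * ((m * 2) * (n * 2)) + ((i * 2 + a) * (n * 2) + (j * 2 + c)) =
        ((k * m + i) * (2 * n) + (a * n + j)) * 2 + c"
      by (simp add: algebra_simps)
    then show ?thesis unfolding r(1) qubit_block_index[OF r(2,3)] slice_def index_vec[OF l1] by (simp only:)
  qed
  also have "\<dots> = (\<Sum>p<e * m * (n * 2). \<Sum>c'<2. (1\<^sub>m (e * m) \<otimes>\<^sub>k swap_mat n 2) $$ ((k * m + i) * (2 * n) + (a * n + j), p) *
      1\<^sub>m 2 $$ (c, c') * ?u $ (p * 2 + c'))"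
    unfolding reorder_def using r kij by (intro kron_mult_vec_index[OF IS one_carrier_mat u'] pair_less) auto
  also have "\<dots> = (\<Sum>p<e * m * (n * 2). (1\<^sub>m (e * m) \<otimes>\<^sub>k swap_mat n 2) $$ ((k * m + i) * (2 * n) + (a * n + j), p) *
      ?u $ (p * 2 + c))"
  proof (intro sum.cong refl)
    fix p
    have "(\<Sum>c'<2. z * 1\<^sub>m 2 $$ (c, c') * ?u $ (p * 2 + c')) =
      (\<Sum>c'<2. if c' = c then z * ?u $ (p * 2 + c) else 0)" for z
      using r by (intro sum.cong refl) auto
    then show "(\<Sum>c'<2. (1\<^sub>m (e * m) \<otimes>\<^sub>k swap_mat n 2) $$ ((k * m + i) * (2 * n) + (a * n + j), p) *
      1\<^sub>m 2 $$ (c, c') * ?u $ (p * 2 + c')) =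
      (1\<^sub>m (e * m) \<otimes>\<^sub>k swap_mat n 2) $$ ((k * m + i) * (2 * n) + (a * n + j), p) * ?u $ (p * 2 + c)"
      using r by simp
  qed
  also have "\<dots> = (\<Sum>t<e * m. \<Sum>s<n * 2. if s = j * 2 + a then if t = k * m + i then
      ?u $ (((k * m + i) * (n * 2) + (j * 2 + a)) * 2 + c) else 0 else 0)"
    unfolding sum_pair[of _ "e * m" "n * 2"]
  proof (intro sum.cong refl)
    fix t s assume "t \<in> {..<e * m}" "s \<in> {..<n * 2}"
    then have ts: "t < e * m" "s < n * 2" by auto
    show "(1\<^sub>m (e * m) \<otimes>\<^sub>k swap_mat n 2) $$ ((k * m + i) * (2 * n) + (a * n + j), t * (n * 2) + s) *
      ?u $ ((t * (n * 2) + s) * 2 + c) = (if s = j * 2 + a then if t = k * m + i then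
      ?u $ (((k * m + i) * (n * 2) + (j * 2 + a)) * 2 + c) else 0 else 0)"
      unfolding kron_index[OF one_carrier_mat S km aj ts] Si[OF ts(2)] index_one_mat(1)[OF km ts(1)] eq_commute[of "k * m + i" t]
      by (cases "s = j * 2 + a"; cases "t = k * m + i") (simp_all only: if_True if_False refl simp_thms mult_1 mult_zero_left mult_zero_right mult_1_right)
  qed
  also have "\<dots> = ?u $ (((k * m + i) * (n * 2) + (j * 2 + a)) * 2 + c)"
    using km pair_less[OF kij(3) r(2)] by simp
  also have "((k * m + i) * (n * 2) + (j * 2 + a)) * 2 + c = ((k * m + i) * n + j) * (2 * 2) + (a * 2 + c)"
    by (simp add: algebra_simps)
  also have "?u $ \<dots> = \<xi> $ ((k * m + i) * n + j) * \<chi> $ r"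
    unfolding r(1) using km kij r pair_less[OF r(2,3)] by (intro ui pair_less)
  finally show "qubit_block n (slice ((m * 2) * (n * 2)) (reorder e m n *\<^sub>v ?u) k) i j $ r =
    (\<xi> $ ((k * m + i) * n + j) \<cdot>\<^sub>v \<chi>) $ r" using r pair_less[OF r(2,3)] chi by simp
qed (use chi in \<open>auto simp: qubit_block_def\<close>)

section \<open>Self-testing\<close>

lemma unitary_intertwine:
  assumes U: "is_unitary n U" and N: "N \<in> carrier_mat n n" and conj: "U * N * mat_adjoint U = A"
  shows "A * U = U * N"
proof -
  have Uc: "U \<in> carrier_mat n n" "mat_adjoint U * U = 1\<^sub>m n" using U by (auto simp: is_unitary_def)
  have "A * U = U * N * (mat_adjoint U * U)"
    using Uc(1) N by (simp add: conj[symmetric] mult_mat_assoc)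
  then show ?thesis using Uc N by simp
qed

lemma proj_vec_index: "r < dim_vec v \<Longrightarrow> s < dim_vec v \<Longrightarrow> proj v $$ (r, s) = v $ r * cnj (v $ s)"
  by (simp add: proj_def)

locale qubit_self_test =
  fixes b :: bell and \<eta> :: real and \<psi> :: "complex vec" and A B :: "bool \<Rightarrow> complex mat"
  assumes bound: "is_quantum_bound b \<eta>"
    and target_state: "pure_state (2 * 2) \<psi>"
    and target_A: "observable 2 (A x)"
    and target_B: "observable 2 (B y)"
    and two_qubit: "strategy 2 2 \<rho>q Aq Bq \<Longrightarrow> bell_value b 2 2 \<rho>q Aq Bq = \<eta> \<Longrightarrow>
      \<exists>UA UB. is_unitary 2 UA \<and> is_unitary 2 UB \<and>
        (UA \<otimes>\<^sub>k UB) * \<rho>q * (mat_adjoint UA \<otimes>\<^sub>k mat_adjoint UB) = proj \<psi> \<and>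
        (\<forall>x. UA * Aq x * mat_adjoint UA = A x) \<and>
        (\<forall>y. UB * Bq y * mat_adjoint UB = B y)"
begin

lemma psi: "\<psi> \<in> carrier_vec (2 * 2)" "\<psi> \<bullet>c \<psi> = 1" "norm_sq \<psi> = 1"
  using target_state by (auto simp: pure_state_def norm_sq_def)

text \<open>The quantum bound in homogeneous form. A nonzero vector is normalised to a pure state,
  and both sides scale with the squared norm; for the zero vector both sides are 0.\<close>

lemma bell_exp_le:
  assumes N: "\<And>x. observable dA (N x)" and M: "\<And>y. observable dB (M y)" and v: "v \<in> carrier_vec (dA * dB)"
  shows "bell_exp b dA dB N M v \<le> \<eta> * norm_sq v"
proof (cases "v = 0\<^sub>v (dA * dB)")
  case True
  have "bell_operator b dA dB N M *\<^sub>v v \<in> carrier_vec (dA * dB)"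
    using bell_operator_carrier[OF observableD(1)[OF N] observableD(1)[OF M]] v by (rule mult_mat_vec_carrier)
  then show ?thesis by (simp add: True bell_exp_def norm_sq_def)
next
  case False
  obtain c where c: "c > 0" "c * c * norm_sq v = 1" "complex_of_real c \<cdot>\<^sub>v v \<in> carrier_vec (dA * dB)"
    "norm_sq (complex_of_real c \<cdot>\<^sub>v v) = 1" using normalise[OF v False] .
  define w where "w = complex_of_real c \<cdot>\<^sub>v v"
  have "strategy dA dB (ensemble (dA * dB) 1 (\<lambda>_. w)) N M"
    unfolding strategy_def using c N M
    by (auto intro!: density_ensemble simp: w_def cscalar_prod_norm_sq)
  then have "bell_value b dA dB (ensemble (dA * dB) 1 (\<lambda>_. w)) N M \<le> \<eta>"
    using bound by (auto simp: is_quantum_bound_def)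
  also have "bell_value b dA dB (ensemble (dA * dB) 1 (\<lambda>_. w)) N M = c * c * bell_exp b dA dB N M v"
    using c(3) bell_exp_smult[OF observableD(1)[OF N] observableD(1)[OF M] v, where b=b and c="complex_of_real c"]
    by (simp add: bell_value_ensemble[OF observableD(1)[OF N] observableD(1)[OF M]] w_def power2_eq_square)
  finally have "c * c * bell_exp b dA dB N M v * norm_sq v \<le> \<eta> * norm_sq v"
    using norm_sq_pos[OF v False] by (intro mult_right_mono) auto
  then show ?thesis using c(2) by (metis mult.assoc mult.commute mult_1)
qed

text \<open>The two-qubit hypothesis for states given as mixtures. It is used with one vector to
  obtain rotations and with two vectors to prove uniqueness.\<close>

lemma optimal_rotation:
  assumes N: "\<And>x. observable 2 (N x)" and M: "\<And>y. observable 2 (M y)"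
    and v: "\<And>k. v k \<in> carrier_vec (2 * 2)" "(\<Sum>k<e. norm_sq (v k)) = 1"
    and opt: "(\<Sum>k<e. bell_exp b 2 2 N M (v k)) = \<eta>"
  obtains UA UB where "is_unitary 2 UA" "is_unitary 2 UB"
    "ensemble (2 * 2) e (\<lambda>k. (UA \<otimes>\<^sub>k UB) *\<^sub>v v k) = proj \<psi>"
    "\<And>x. UA * N x * mat_adjoint UA = A x" "\<And>y. UB * M y * mat_adjoint UB = B y"
proof -
  have "(\<Sum>k<e. v k \<bullet>c v k) = 1"
    using v(2) by (simp add: cscalar_prod_norm_sq flip: of_real_sum)
  then have "strategy 2 2 (ensemble (2 * 2) e v) N M"
    unfolding strategy_def using N M v by (auto intro!: density_ensemble)
  moreover have "bell_value b 2 2 (ensemble (2 * 2) e v) N M = \<eta>"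
    unfolding opt[symmetric] by (rule bell_value_ensemble[OF observableD(1)[OF N] observableD(1)[OF M] v(1)])
  ultimately obtain UA UB where U: "is_unitary 2 UA" "is_unitary 2 UB"
    "(UA \<otimes>\<^sub>k UB) * ensemble (2 * 2) e v * (mat_adjoint UA \<otimes>\<^sub>k mat_adjoint UB) = proj \<psi>"
    "\<And>x. UA * N x * mat_adjoint UA = A x" "\<And>y. UB * M y * mat_adjoint UB = B y"
    using two_qubit by metis
  have "UA \<otimes>\<^sub>k UB \<in> carrier_mat (2 * 2) (2 * 2)" using U by (auto simp: is_unitary_def)
  then have "ensemble (2 * 2) e (\<lambda>k. (UA \<otimes>\<^sub>k UB) *\<^sub>v v k) = proj \<psi>"
    using U(3) ensemble_conjugate[of "UA \<otimes>\<^sub>k UB" "2 * 2" "2 * 2" v e] v(1) by (simp add: mat_adjoint_kron)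
  then show ?thesis using that U by blast
qed

lemma bell_exp_unitary:
  assumes N: "\<And>x. observable 2 (N x)" and M: "\<And>y. observable 2 (M y)" and v: "v \<in> carrier_vec (2 * 2)"
    and U: "is_unitary 2 UA" "is_unitary 2 UB"
    and conj: "\<And>x. UA * N x * mat_adjoint UA = A x" "\<And>y. UB * M y * mat_adjoint UB = B y"
  shows "bell_exp b 2 2 A B ((UA \<otimes>\<^sub>k UB) *\<^sub>v v) = bell_exp b 2 2 N M v"
proof -
  note O = observableD(1)[OF N] observableD(1)[OF M] observableD(1)[OF target_A] observableD(1)[OF target_B]
  have "UA \<in> carrier_mat 2 2" "mat_adjoint UA * UA = 1\<^sub>m 2" "UB \<in> carrier_mat 2 2" "mat_adjoint UB * UB = 1\<^sub>m 2"
    using U by (auto simp: is_unitary_def)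
  then show ?thesis
    using unitary_intertwine[OF U(1) O(1) conj(1)] unitary_intertwine[OF U(2) O(2) conj(2)] v
    by (intro bell_exp_isometry O)
qed

text \<open>An equal mixture of two optimal states is optimal, hence pure, so the two states are parallel.\<close>
lemma optimal_unique:
  assumes v: "v \<in> carrier_vec (2 * 2)" and opt: "bell_exp b 2 2 A B v = \<eta> * norm_sq v"
  obtains c where "v = c \<cdot>\<^sub>v \<psi>"
proof (cases "v = 0\<^sub>v (2 * 2)")
  case True
  then have "v = 0 \<cdot>\<^sub>v \<psi>" using psi by (intro eq_vecI) auto
  then show ?thesis by (rule that)
next
  case False
  note O = observableD(1)[OF target_A] observableD(1)[OF target_B]
  obtain c where c: "c > 0" "c * c * norm_sq v = 1" "complex_of_real c \<cdot>\<^sub>v v \<in> carrier_vec (2 * 2)"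
    "norm_sq (complex_of_real c \<cdot>\<^sub>v v) = 1" using normalise[OF v False] .
  define w where "w = complex_of_real c \<cdot>\<^sub>v v"
  have w: "w \<in> carrier_vec (2 * 2)" "norm_sq w = 1" using c by (auto simp: w_def)
  have wopt: "bell_exp b 2 2 A B w = \<eta>"
    using c(2) bell_exp_smult[OF O v, where c="complex_of_real c" and b=b] opt
    by (simp add: w_def power2_eq_square mult_ac)
  \<comment> \<open>The hypothesis is applied to the target observables themselves: the unitaries
    obtained commute with them and carry \<open>w\<close> to \<open>\<psi>\<close> up to a
    phase.\<close>
  obtain UA UB where U: "is_unitary 2 UA" "is_unitary 2 UB"
    "ensemble (2 * 2) 1 (\<lambda>k. (UA \<otimes>\<^sub>k UB) *\<^sub>v w) = proj \<psi>"
    "\<And>x. UA * A x * mat_adjoint UA = A x" "\<And>y. UB * B y * mat_adjoint UB = B y"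
  proof -
    have "(\<Sum>k<(1::nat). norm_sq w) = 1" "(\<Sum>k<(1::nat). bell_exp b 2 2 A B w) = \<eta>"
      using w wopt by simp_all
    then show ?thesis
      by (rule optimal_rotation[of A B "\<lambda>_. w" 1, OF target_A target_B w(1)]) (rule that; assumption)
  qed
  have Uw: "(UA \<otimes>\<^sub>k UB) *\<^sub>v w \<in> carrier_vec (2 * 2)"
    using U w by (intro mult_mat_vec_carrier[of _ "2 * 2" "2 * 2"]) (auto simp: is_unitary_def)
  \<comment> \<open>Optimality of \<open>\<psi>\<close> for the target observables is inherited from
    \<open>w\<close>: the rotated \<open>w\<close> and \<open>\<psi>\<close> have the same
    projector, and the rotation preserves the value.\<close>
  have "bell_exp b 2 2 A B \<psi> = bell_value b 2 2 (ensemble (2 * 2) 1 (\<lambda>_. \<psi>)) A B"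
    using psi by (subst bell_value_ensemble[OF O]) auto
  also have "ensemble (2 * 2) 1 (\<lambda>_. \<psi>) = ensemble (2 * 2) 1 (\<lambda>k. (UA \<otimes>\<^sub>k UB) *\<^sub>v w)"
    unfolding U(3) using psi by (intro ensemble_1)
  also have "bell_value b 2 2 \<dots> A B = bell_exp b 2 2 A B ((UA \<otimes>\<^sub>k UB) *\<^sub>v w)"
    using Uw by (subst bell_value_ensemble[OF O]) auto
  also have "\<dots> = \<eta>" using bell_exp_unitary[OF target_A target_B w(1) U(1,2) U(4,5)] wopt by simp
  finally have popt: "bell_exp b 2 2 A B \<psi> = \<eta>" .
  \<comment> \<open>Scaling by \<open>s\<close> gives each of the two unit vectors the weight
    1/2.\<close>
  define s where "s = complex_of_real (1 / sqrt 2)"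
  have ss: "(cmod s)\<^sup>2 = 1 / 2" by (simp add: s_def power_divide norm_divide)
  define m where "m = (\<lambda>k::nat. s \<cdot>\<^sub>v (if k = 0 then w else \<psi>))"
  have mc: "m k \<in> carrier_vec (2 * 2)" for k using w psi by (simp add: m_def)
  have m2: "(\<Sum>k<2. g (m k)) = g (s \<cdot>\<^sub>v w) + g (s \<cdot>\<^sub>v \<psi>)" for g :: "complex vec \<Rightarrow> real"
    by (simp add: m_def numeral_2_eq_2)
  have m_norm: "(\<Sum>k<2. norm_sq (m k)) = 1"
    unfolding m2 norm_sq_smult ss by (simp add: w psi)
  have m_opt: "(\<Sum>k<2. bell_exp b 2 2 A B (m k)) = \<eta>"
    unfolding m2 bell_exp_smult[OF O w(1)] bell_exp_smult[OF O psi(1)] ss by (simp add: wopt popt)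
  obtain WA WB where W: "is_unitary 2 WA" "is_unitary 2 WB"
    "ensemble (2 * 2) 2 (\<lambda>k. (WA \<otimes>\<^sub>k WB) *\<^sub>v m k) = proj \<psi>"
    by (rule optimal_rotation[of A B m 2, OF target_A target_B mc m_norm m_opt])
  define W where "W = WA \<otimes>\<^sub>k WB"
  have Wc: "W \<in> carrier_mat (2 * 2) (2 * 2)" and WW: "mat_adjoint W * W = 1\<^sub>m (2 * 2)"
    unfolding W_def using W(1,2) by (auto simp: is_unitary_def intro!: isometry_kron[of _ 2 2 _ 2 2, simplified])
  define p where "p = (\<lambda>k. W *\<^sub>v m k)"
  have pc: "p k \<in> carrier_vec (2 * 2)" for k unfolding p_def using Wc mc by (rule mult_mat_vec_carrier)
  \<comment> \<open>The mixture is rotated into a pure state, so the two rank-one terms add up to a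
    single one. This supplies \<open>minors_of_rank_one\<close> with its assumptions for any two
    indices.\<close>
  have ent: "p 0 $ r * cnj (p 0 $ t) + p 1 $ r * cnj (p 1 $ t) = \<psi> $ r * cnj (\<psi> $ t)"
    if "r < 2 * 2" "t < 2 * 2" for r t
  proof -
    have "ensemble (2 * 2) 2 p $$ (r, t) = proj \<psi> $$ (r, t)" using W(3) by (simp only: p_def W_def)
    moreover have "proj \<psi> $$ (r, t) = \<psi> $ r * cnj (\<psi> $ t)" using that psi by (intro proj_vec_index) auto
    ultimately show ?thesis using that by (simp add: ensemble_def numeral_2_eq_2)
  qed
  have s0: "s \<noteq> 0" by (simp add: s_def)
  have p1: "p 1 = s \<cdot>\<^sub>v (W *\<^sub>v \<psi>)" "p 0 = s \<cdot>\<^sub>v (W *\<^sub>v w)"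
    unfolding p_def m_def using Wc psi w by (simp_all add: mult_mat_vec[of _ "2 * 2" "2 * 2"])
  define q where "q = W *\<^sub>v \<psi>"
  have q: "q \<in> carrier_vec (2 * 2)" unfolding q_def using Wc psi(1) by (rule mult_mat_vec_carrier)
  have qq: "q \<bullet>c q = 1" unfolding q_def using isometry_cscalar_prod[OF Wc WW psi(1) psi(1)] psi by simp
  have y: "W *\<^sub>v w \<in> carrier_vec (2 * 2)" using Wc w(1) by (rule mult_mat_vec_carrier)
  have "(W *\<^sub>v w) $ r * q $ t = (W *\<^sub>v w) $ t * q $ r" if rt: "r < 2 * 2" "t < 2 * 2" for r t
  proof -
    have "p 0 $ r * p 1 $ t = p 0 $ t * p 1 $ r"
      by (rule minors_of_rank_one[OF ent[OF rt(1) rt(1)] ent[OF rt(1) rt(2)] ent[OF rt(2) rt(1)] ent[OF rt(2) rt(2)]])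
    then have "(s * s) * ((W *\<^sub>v w) $ r * q $ t) = (s * s) * ((W *\<^sub>v w) $ t * q $ r)"
      unfolding p1 q_def[symmetric] using rt carrier_vecD[OF q] carrier_vecD[OF y]
      by (simp only: index_smult_vec mult_ac)
    then show ?thesis using s0 by simp
  qed
  then have "W *\<^sub>v w = ((W *\<^sub>v w) \<bullet>c q) \<cdot>\<^sub>v q" by (rule proportional[OF y q qq])
  then obtain d where d: "W *\<^sub>v w = d \<cdot>\<^sub>v q" by blast
  \<comment> \<open>So far only the images of \<open>w\<close> and \<open>\<psi>\<close> under
    \<open>W\<close> are known to be parallel; undoing \<open>W\<close> transfers this to the
    vectors.\<close>
  have inv: "mat_adjoint W *\<^sub>v (W *\<^sub>v z) = z" if "z \<in> carrier_vec (2 * 2)" for z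
    using that Wc WW by (subst mult_mat_vec_assoc[symmetric]) auto
  have "w = mat_adjoint W *\<^sub>v (d \<cdot>\<^sub>v q)" using inv[OF w(1)] d by simp
  also have "\<dots> = d \<cdot>\<^sub>v (mat_adjoint W *\<^sub>v q)" using mat_adjoint_carrier[OF Wc] q by (rule mult_mat_vec)
  also have "\<dots> = d \<cdot>\<^sub>v \<psi>" unfolding q_def inv[OF psi(1)] ..
  finally have wd: "w = d \<cdot>\<^sub>v \<psi>" .
  have "v = (1 / complex_of_real c) \<cdot>\<^sub>v w" using c(1) by (simp add: w_def smult_smult_assoc)
  then have "v = (d / complex_of_real c) \<cdot>\<^sub>v \<psi>" by (simp add: wd smult_smult_assoc)
  then show ?thesis by (rule that)
qed

text \<open>The rotation is a function of the observables of the block only, so that it does not depend on the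
  purification. Blocks that cannot be rotated into the target carry no weight in an optimal state.\<close>
definition rotation :: "(bool \<Rightarrow> complex mat) \<Rightarrow> (bool \<Rightarrow> complex mat) \<Rightarrow> complex mat" where
  "rotation T N =
    (if \<exists>U. is_unitary 2 U \<and> (\<forall>x. U * N x * mat_adjoint U = T x)
     then SOME U. is_unitary 2 U \<and> (\<forall>x. U * N x * mat_adjoint U = T x) else 1\<^sub>m 2)"

lemma rotation_unitary: "is_unitary 2 (rotation T N)"
proof (cases "\<exists>U. is_unitary 2 U \<and> (\<forall>x. U * N x * mat_adjoint U = T x)")
  case True
  from someI_ex[OF this] True show ?thesis by (simp add: rotation_def)
next
  case False
  have "is_unitary 2 (1\<^sub>m 2)" by (simp add: is_unitary_def)
  then show ?thesis unfolding rotation_def if_not_P[OF False] .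
qed

lemma rotation_conjugates:
  assumes "is_unitary 2 U" "\<And>x. U * N x * mat_adjoint U = T x"
  shows "rotation T N * N x * mat_adjoint (rotation T N) = T x"
proof -
  have e: "\<exists>U. is_unitary 2 U \<and> (\<forall>x. U * N x * mat_adjoint U = T x)" using assms by blast
  from someI_ex[OF this] show ?thesis unfolding rotation_def if_P[OF e] by blast
qed

text \<open>Conjugating the block observables to the target ones preserves the value, so the rotated
  vector is optimal for the target observables and \<open>optimal_unique\<close> yields the scalar.
  Its squared modulus is the weight of the block, which will normalise the junk state.\<close>

lemma optimal_block:
  assumes N: "\<And>x. observable 2 (N x)" and M: "\<And>y. observable 2 (M y)" and v: "v \<in> carrier_vec (2 * 2)"
    and opt: "bell_exp b 2 2 N M v = \<eta> * norm_sq v"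
  shows "\<exists>c. (cmod c)\<^sup>2 = norm_sq v \<and>
    (\<forall>x y. (rotation A N \<otimes>\<^sub>k rotation B M) *\<^sub>v ((N x \<otimes>\<^sub>k M y) *\<^sub>v v) = c \<cdot>\<^sub>v ((A x \<otimes>\<^sub>k B y) *\<^sub>v \<psi>))"
proof (cases "v = 0\<^sub>v (2 * 2)")
  case True
  note O = observableD(1)[OF N] observableD(1)[OF M] observableD(1)[OF target_A] observableD(1)[OF target_B]
  have R: "rotation A N \<in> carrier_mat 2 2" "rotation B M \<in> carrier_mat 2 2"
    using rotation_unitary by (auto simp: is_unitary_def)
  \<comment> \<open>The scalar 0 works for any rotations, also where \<open>rotation\<close> falls
    back to the identity.\<close>
  have "(rotation A N \<otimes>\<^sub>k rotation B M) *\<^sub>v ((N x \<otimes>\<^sub>k M y) *\<^sub>v v) = 0 \<cdot>\<^sub>v ((A x \<otimes>\<^sub>k B y) *\<^sub>v \<psi>)" for x y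
  proof -
    have "(N x \<otimes>\<^sub>k M y) *\<^sub>v v = 0\<^sub>v (2 * 2)"
      unfolding True by (rule mult_mat_zero_vec[OF kron_carrier[OF O(1,2)]])
    moreover have "(rotation A N \<otimes>\<^sub>k rotation B M) *\<^sub>v 0\<^sub>v (2 * 2) = 0\<^sub>v (2 * 2)"
      by (rule mult_mat_zero_vec[OF kron_carrier[OF R]])
    moreover have "0 \<cdot>\<^sub>v ((A x \<otimes>\<^sub>k B y) *\<^sub>v \<psi>) = 0\<^sub>v (2 * 2)"
      using carrier_matD[OF O(3)] carrier_matD[OF O(4)] by (intro eq_vecI) auto
    ultimately show ?thesis by simp
  qed
  moreover have "norm_sq v = 0" by (simp add: True norm_sq_def)
  ultimately show ?thesis by (intro exI[of _ 0]) auto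
next
  case False
  note O = observableD(1)[OF N] observableD(1)[OF M] observableD(1)[OF target_A] observableD(1)[OF target_B]
  obtain c where c: "c > 0" "c * c * norm_sq v = 1" "complex_of_real c \<cdot>\<^sub>v v \<in> carrier_vec (2 * 2)"
    "norm_sq (complex_of_real c \<cdot>\<^sub>v v) = 1" using normalise[OF v False] .
  define w where "w = complex_of_real c \<cdot>\<^sub>v v"
  have w: "w \<in> carrier_vec (2 * 2)" "norm_sq w = 1" using c by (auto simp: w_def)
  have wopt: "bell_exp b 2 2 N M w = \<eta>"
    using c(2) bell_exp_smult[OF O(1,2) v, where c="complex_of_real c" and b=b] opt
    by (simp add: w_def power2_eq_square mult_ac)
  \<comment> \<open>These unitaries depend on both parties and on \<open>w\<close>. They serve only
    as witnesses that \<open>rotation\<close> finds a conjugating unitary on either side.\<close>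
  obtain UA UB where U: "is_unitary 2 UA" "is_unitary 2 UB"
    "\<And>x. UA * N x * mat_adjoint UA = A x" "\<And>y. UB * M y * mat_adjoint UB = B y"
  proof -
    have "(\<Sum>k<(1::nat). norm_sq w) = 1" "(\<Sum>k<(1::nat). bell_exp b 2 2 N M w) = \<eta>"
      using w wopt by simp_all
    then show ?thesis
      by (rule optimal_rotation[of N M "\<lambda>_. w" 1, OF N M w(1)]) (rule that; assumption)
  qed
  define RA where "RA = rotation A N"
  define RB where "RB = rotation B M"
  have R: "is_unitary 2 RA" "is_unitary 2 RB" "\<And>x. RA * N x * mat_adjoint RA = A x"
    "\<And>y. RB * M y * mat_adjoint RB = B y"
    unfolding RA_def RB_def
    by (rule rotation_unitary rotation_conjugates[of UA N A, OF U(1,3)] rotation_conjugates[of UB M B, OF U(2,4)])+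
  have Rc: "RA \<in> carrier_mat 2 2" "RB \<in> carrier_mat 2 2" "mat_adjoint RA * RA = 1\<^sub>m 2" "mat_adjoint RB * RB = 1\<^sub>m 2"
    using R by (auto simp: is_unitary_def)
  have RR: "RA \<otimes>\<^sub>k RB \<in> carrier_mat (2 * 2) (2 * 2)" using Rc by auto
  have Rv: "(RA \<otimes>\<^sub>k RB) *\<^sub>v v \<in> carrier_vec (2 * 2)" using RR v by (rule mult_mat_vec_carrier)
  have nR: "norm_sq ((RA \<otimes>\<^sub>k RB) *\<^sub>v v) = norm_sq v"
    by (rule norm_sq_isometry[OF RR isometry_kron[OF Rc(1,3) Rc(2,4)] v])
  have "bell_exp b 2 2 A B ((RA \<otimes>\<^sub>k RB) *\<^sub>v v) = \<eta> * norm_sq ((RA \<otimes>\<^sub>k RB) *\<^sub>v v)"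
    unfolding nR bell_exp_unitary[OF N M v R] by (rule opt)
  from optimal_unique[OF Rv this] obtain d where d: "(RA \<otimes>\<^sub>k RB) *\<^sub>v v = d \<cdot>\<^sub>v \<psi>" .
  have "(RA \<otimes>\<^sub>k RB) *\<^sub>v ((N x \<otimes>\<^sub>k M y) *\<^sub>v v) = d \<cdot>\<^sub>v ((A x \<otimes>\<^sub>k B y) *\<^sub>v \<psi>)" for x y
  proof -
    have AB: "A x \<otimes>\<^sub>k B y \<in> carrier_mat (2 * 2) (2 * 2)" by (intro kron_carrier O)
    have "(RA \<otimes>\<^sub>k RB) *\<^sub>v ((N x \<otimes>\<^sub>k M y) *\<^sub>v v) = ((RA \<otimes>\<^sub>k RB) * (N x \<otimes>\<^sub>k M y)) *\<^sub>v v"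
      using carrier_matD[OF O(1)] carrier_matD[OF O(2)] carrier_matD[OF Rc(1)] carrier_matD[OF Rc(2)] carrier_vecD[OF v]
      by (intro mult_mat_vec_assoc[symmetric]) auto
    also have "\<dots> = ((A x \<otimes>\<^sub>k B y) * (RA \<otimes>\<^sub>k RB)) *\<^sub>v v"
      by (simp only: kron_mult[OF Rc(1,2) O(1,2)] kron_mult[OF O(3,4) Rc(1,2)]
        unitary_intertwine[OF R(1) O(1) R(3)] unitary_intertwine[OF R(2) O(2) R(4)])
    also have "\<dots> = (A x \<otimes>\<^sub>k B y) *\<^sub>v (d \<cdot>\<^sub>v \<psi>)"
      unfolding d[symmetric] using carrier_matD[OF AB] carrier_matD[OF RR] carrier_vecD[OF v]
      by (intro mult_mat_vec_assoc) auto
    finally show ?thesis using mult_mat_vec[OF AB psi(1)] by simp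
  qed
  moreover have "(cmod d)\<^sup>2 = norm_sq v" using nR unfolding d norm_sq_smult by (simp add: psi)
  ultimately show ?thesis unfolding RA_def RB_def by blast
qed

end

section \<open>From optimal blocks to the whole state\<close>

lemma purification_ensemble:
  assumes "purification e d \<rho> \<Psi>"
  shows "\<Psi> \<in> carrier_vec (e * d)" "norm_sq \<Psi> = 1" "\<rho> = ensemble d e (slice d \<Psi>)"
proof -
  show P: "\<Psi> \<in> carrier_vec (e * d)" and "norm_sq \<Psi> = 1"
    using assms by (auto simp: purification_def pure_state_def norm_sq_def)
  have "\<rho> = ptrace_fst e d (proj \<Psi>)" using assms by (simp add: purification_def)
  also have "\<dots> = ensemble d e (slice d \<Psi>)"
    using P by (intro eq_matI) (auto simp: ptrace_fst_def ensemble_def slice_def proj_vec_index pair_less intro!: sum.cong)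
  finally show "\<rho> = ensemble d e (slice d \<Psi>)" .
qed

lemma block_sum_unitary:
  assumes "\<And>i. i < f \<Longrightarrow> is_unitary 2 (U i)"
  shows "is_unitary (f * 2) (block_sum f U)"
proof -
  have U: "\<And>i. i < f \<Longrightarrow> U i \<in> carrier_mat 2 2" "\<And>i. i < f \<Longrightarrow> mat_adjoint (U i) \<in> carrier_mat 2 2"
    "\<And>i. i < f \<Longrightarrow> mat_adjoint (U i) * U i = 1\<^sub>m 2" "\<And>i. i < f \<Longrightarrow> U i * mat_adjoint (U i) = 1\<^sub>m 2"
    using assms by (auto simp: is_unitary_def)
  have "block_sum f (\<lambda>i. mat_adjoint (U i) * U i) = block_sum f (\<lambda>i. 1\<^sub>m 2)"
    "block_sum f (\<lambda>i. U i * mat_adjoint (U i)) = block_sum f (\<lambda>i. 1\<^sub>m 2)"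
    unfolding block_sum_def using U by (auto intro!: arg_cong[of _ _ diag_block_mat])
  then show ?thesis
    using U by (simp add: is_unitary_def block_sum_carrier block_sum_adjoint block_sum_mult block_sum_one)
qed

lemma kron_mult_vec_vec:
  assumes "M \<in> carrier_mat m k" "N \<in> carrier_mat n l" "M' \<in> carrier_mat k m'" "N' \<in> carrier_mat l n'"
    and "v \<in> carrier_vec (m' * n')"
  shows "(M \<otimes>\<^sub>k N) *\<^sub>v ((M' \<otimes>\<^sub>k N') *\<^sub>v v) = ((M * M') \<otimes>\<^sub>k (N * N')) *\<^sub>v v"
proof -
  have "(M \<otimes>\<^sub>k N) *\<^sub>v ((M' \<otimes>\<^sub>k N') *\<^sub>v v) = ((M \<otimes>\<^sub>k N) * (M' \<otimes>\<^sub>k N')) *\<^sub>v v"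
    using assms by (subst mult_mat_vec_assoc) auto
  then show ?thesis by (simp only: kron_mult[OF assms(1-4)])
qed

context qubit_self_test
begin

text \<open>\<open>VA\<close> and \<open>VB\<close> are built from the blocks of the observables
  alone, so the same pair serves every purification.\<close>

lemma self_test:
  assumes strat: "strategy dA dB \<rho> At Bt" and optimal: "bell_value b dA dB \<rho> At Bt = \<eta>"
    and JA: "jordan_identification dA At fA JA NA" and JB: "jordan_identification dB Bt fB JB NB"
    and pur: "purification e (dA * dB) \<rho> \<Psi>"
  defines "VA \<equiv> block_sum fA (\<lambda>i. rotation A (\<lambda>x. NA x i))"
    and "VB \<equiv> block_sum fB (\<lambda>j. rotation B (\<lambda>y. NB y j))"
  shows "\<exists>\<xi>. pure_state (e * fA * fB) \<xi> \<and>
    (\<forall>x y. (1\<^sub>m e \<otimes>\<^sub>k VA \<otimes>\<^sub>k VB) *\<^sub>v ((1\<^sub>m e \<otimes>\<^sub>k JA \<otimes>\<^sub>k JB) *\<^sub>v ((1\<^sub>m e \<otimes>\<^sub>k At x \<otimes>\<^sub>k Bt y) *\<^sub>v \<Psi>)) =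
      reorder e fA fB *\<^sub>v (\<xi> \<otimes>\<^sub>v ((A x \<otimes>\<^sub>k B y) *\<^sub>v \<psi>)))"
proof -
  have At: "observable dA (At x)" and Bt: "observable dB (Bt y)" for x y
    using strat by (auto simp: strategy_def)
  have ja: "JA \<in> carrier_mat (fA * 2) dA" "mat_adjoint JA * JA = 1\<^sub>m dA"
    "\<And>x i. i < fA \<Longrightarrow> observable 2 (NA x i)" "\<And>x. block_sum fA (NA x) * JA = JA * At x"
    using JA by (auto simp: jordan_identification_def)
  have jb: "JB \<in> carrier_mat (fB * 2) dB" "mat_adjoint JB * JB = 1\<^sub>m dB"
    "\<And>y j. j < fB \<Longrightarrow> observable 2 (NB y j)" "\<And>y. block_sum fB (NB y) * JB = JB * Bt y"
    using JB by (auto simp: jordan_identification_def)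
  note na = observableD(1)[OF ja(3)] and nb = observableD(1)[OF jb(3)]
  note bna = block_sum_carrier[of fA "NA _", OF na] and bnb = block_sum_carrier[of fB "NB _", OF nb]
  define D where "D = (fA * 2) * (fB * 2)"
  note P = purification_ensemble[OF pur]
  define \<Phi> where "\<Phi> = (\<lambda>k. (JA \<otimes>\<^sub>k JB) *\<^sub>v slice (dA * dB) \<Psi> k)"
  have JJ: "JA \<otimes>\<^sub>k JB \<in> carrier_mat ((fA * 2) * (fB * 2)) (dA * dB)" using ja jb by (intro kron_carrier)
  have Phi: "\<Phi> k \<in> carrier_vec ((fA * 2) * (fB * 2))" for k
    unfolding \<Phi>_def using JJ slice_carrier by (rule mult_mat_vec_carrier)
  define \<phi> where "\<phi> = (\<lambda>k i j. qubit_block fB (\<Phi> k) i j)"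
  have phi: "\<phi> k i j \<in> carrier_vec (2 * 2)" for k i j unfolding \<phi>_def by (rule qubit_block_carrier)
  define E where "E = (\<lambda>k i j. bell_exp b 2 2 (\<lambda>x. NA x i) (\<lambda>y. NB y j) (\<phi> k i j))"
  have norm: "(\<Sum>k<e. \<Sum>i<fA. \<Sum>j<fB. norm_sq (\<phi> k i j)) = 1"
  proof -
    have "norm_sq (\<Phi> k) = norm_sq (slice (dA * dB) \<Psi> k)" for k
      unfolding \<Phi>_def by (rule norm_sq_isometry[OF JJ isometry_kron[OF ja(1,2) jb(1,2)] slice_carrier])
    then show ?thesis
      using P(2) unfolding norm_sq_slices[OF P(1)] \<phi>_def norm_sq_qubit_blocks[OF Phi, symmetric] by simp
  qed
  have total: "(\<Sum>k<e. \<Sum>i<fA. \<Sum>j<fB. E k i j) = \<eta>"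
  proof -
    have "bell_exp b dA dB At Bt (slice (dA * dB) \<Psi> k) = (\<Sum>i<fA. \<Sum>j<fB. E k i j)" for k
    proof -
      have "bell_exp b dA dB At Bt (slice (dA * dB) \<Psi> k) =
        bell_exp b (fA * 2) (fB * 2) (\<lambda>x. block_sum fA (NA x)) (\<lambda>y. block_sum fB (NB y)) (\<Phi> k)"
        unfolding \<Phi>_def using ja jb bna bnb
        by (intro bell_exp_isometry[symmetric] observableD(1)[OF At] observableD(1)[OF Bt] slice_carrier)
      also have "\<dots> = (\<Sum>i<fA. \<Sum>j<fB. E k i j)"
        unfolding E_def \<phi>_def by (rule bell_exp_qubit_blocks[OF na nb Phi])
      finally show ?thesis .
    qed
    then have "(\<Sum>k<e. \<Sum>i<fA. \<Sum>j<fB. E k i j) = bell_value b dA dB \<rho> At Bt"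
      unfolding P(3) by (subst bell_value_ensemble[OF observableD(1)[OF At] observableD(1)[OF Bt]]) auto
    then show ?thesis using optimal by simp
  qed
  have le: "E k i j \<le> \<eta> * norm_sq (\<phi> k i j)" if "i < fA" "j < fB" for k i j
    unfolding E_def using ja(3)[OF that(1)] jb(3)[OF that(2)] phi by (rule bell_exp_le)
  have opt: "E k i j = \<eta> * norm_sq (\<phi> k i j)" if kij: "k < e" "i < fA" "j < fB" for k i j
  proof -
    \<comment> \<open>The gaps to the bound are nonnegative and add up to zero, so each of them is
      zero.\<close>
    define G where "G = (\<lambda>k i j. \<eta> * norm_sq (\<phi> k i j) - E k i j)"
    have G0: "0 \<le> G k i j" if "i < fA" "j < fB" for k i j using le[OF that] by (simp add: G_def)
    have "(\<Sum>k<e. \<Sum>i<fA. \<Sum>j<fB. G k i j) = 0"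
      by (simp add: G_def sum_subtractf total norm flip: sum_distrib_left)
    then have "(\<Sum>i<fA. \<Sum>j<fB. G k i j) = 0"
      using kij G0 by (subst (asm) sum_nonneg_eq_0_iff) (auto intro!: sum_nonneg)
    then have "(\<Sum>j<fB. G k i j) = 0"
      using kij G0 by (subst (asm) sum_nonneg_eq_0_iff) (auto intro!: sum_nonneg)
    then have "G k i j = 0"
      using kij G0 by (subst (asm) sum_nonneg_eq_0_iff) auto
    then show ?thesis by (simp add: G_def)
  qed
  \<comment> \<open>The scalar is chosen before the inputs \<open>x\<close> and \<open>y\<close>,
    since one junk state has to serve all of them.\<close>
  have "\<forall>k i j. k < e \<and> i < fA \<and> j < fB \<longrightarrow> (\<exists>c. (cmod c)\<^sup>2 = norm_sq (\<phi> k i j) \<and>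
    (\<forall>x y. (rotation A (\<lambda>x. NA x i) \<otimes>\<^sub>k rotation B (\<lambda>y. NB y j)) *\<^sub>v ((NA x i \<otimes>\<^sub>k NB y j) *\<^sub>v \<phi> k i j) =
      c \<cdot>\<^sub>v ((A x \<otimes>\<^sub>k B y) *\<^sub>v \<psi>)))"
    using optimal_block[OF ja(3) jb(3) phi opt[unfolded E_def]] by blast
  then obtain c where c: "\<And>k i j. k < e \<Longrightarrow> i < fA \<Longrightarrow> j < fB \<Longrightarrow> (cmod (c k i j))\<^sup>2 = norm_sq (\<phi> k i j)"
    and rot: "\<And>k i j x y. k < e \<Longrightarrow> i < fA \<Longrightarrow> j < fB \<Longrightarrow>
      (rotation A (\<lambda>x. NA x i) \<otimes>\<^sub>k rotation B (\<lambda>y. NB y j)) *\<^sub>v ((NA x i \<otimes>\<^sub>k NB y j) *\<^sub>v \<phi> k i j) =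
      c k i j \<cdot>\<^sub>v ((A x \<otimes>\<^sub>k B y) *\<^sub>v \<psi>)"
    by metis
  \<comment> \<open>This decodes \<open>r = (k * fA + i) * fB + j\<close>, the index of the basis
    vector |k>|i>|j> of the junk space.\<close>
  define \<xi> where "\<xi> = vec (e * fA * fB) (\<lambda>r. c (r div fB div fA) (r div fB mod fA) (r mod fB))"
  have xi: "\<xi> \<in> carrier_vec (e * fA * fB)" by (simp add: \<xi>_def)
  have xi_index: "\<xi> $ ((k * fA + i) * fB + j) = c k i j" if "k < e" "i < fA" "j < fB" for k i j
    using that pair_less[OF pair_less[OF that(1,2)] that(3)] by (simp add: \<xi>_def)
  \<comment> \<open>The squared moduli of the scalars are the weights of the blocks, which add up to
    one.\<close>
  have "norm_sq \<xi> = 1"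
    unfolding norm_sq_index carrier_vecD[OF xi] sum_pair using norm by (simp add: xi_index c)
  then have pure: "pure_state (e * fA * fB) \<xi>"
    using xi by (simp add: pure_state_def cscalar_prod_norm_sq)
  have rA: "rotation A N \<in> carrier_mat 2 2" and rB: "rotation B N \<in> carrier_mat 2 2" for N
    using rotation_unitary by (auto simp: is_unitary_def)
  have VA: "VA \<in> carrier_mat (fA * 2) (fA * 2)" and VB: "VB \<in> carrier_mat (fB * 2) (fB * 2)"
    unfolding VA_def VB_def by (intro block_sum_carrier rA rB)+
  have "(1\<^sub>m e \<otimes>\<^sub>k VA \<otimes>\<^sub>k VB) *\<^sub>v ((1\<^sub>m e \<otimes>\<^sub>k JA \<otimes>\<^sub>k JB) *\<^sub>v ((1\<^sub>m e \<otimes>\<^sub>k At x \<otimes>\<^sub>k Bt y) *\<^sub>v \<Psi>)) =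
      reorder e fA fB *\<^sub>v (\<xi> \<otimes>\<^sub>v ((A x \<otimes>\<^sub>k B y) *\<^sub>v \<psi>))" for x y
  proof (rule vec_eqI_qubit_blocks)
    let ?v2 = "(1\<^sub>m e \<otimes>\<^sub>k (At x \<otimes>\<^sub>k Bt y)) *\<^sub>v \<Psi>"
    let ?v1 = "(1\<^sub>m e \<otimes>\<^sub>k (JA \<otimes>\<^sub>k JB)) *\<^sub>v ?v2"
    let ?lhs = "(1\<^sub>m e \<otimes>\<^sub>k VA \<otimes>\<^sub>k VB) *\<^sub>v ((1\<^sub>m e \<otimes>\<^sub>k JA \<otimes>\<^sub>k JB) *\<^sub>v ((1\<^sub>m e \<otimes>\<^sub>k At x \<otimes>\<^sub>k Bt y) *\<^sub>v \<Psi>))"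
    have AB: "At x \<otimes>\<^sub>k Bt y \<in> carrier_mat (dA * dB) (dA * dB)"
      by (intro kron_carrier observableD(1)[OF At] observableD(1)[OF Bt])
    have VV: "VA \<otimes>\<^sub>k VB \<in> carrier_mat ((fA * 2) * (fB * 2)) ((fA * 2) * (fB * 2))"
      by (intro kron_carrier VA VB)
    have v2: "?v2 \<in> carrier_vec (e * (dA * dB))"
      by (rule mult_mat_vec_carrier[OF kron_carrier[OF one_carrier_mat AB] P(1)])
    have v1: "?v1 \<in> carrier_vec (e * ((fA * 2) * (fB * 2)))"
      by (rule mult_mat_vec_carrier[OF kron_carrier[OF one_carrier_mat JJ] v2])
    have lhs: "?lhs = (1\<^sub>m e \<otimes>\<^sub>k (VA \<otimes>\<^sub>k VB)) *\<^sub>v ?v1" by (simp only: kron_assoc)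
    show "?lhs \<in> carrier_vec (e * ((fA * 2) * (fB * 2)))"
      unfolding lhs by (rule mult_mat_vec_carrier[OF kron_carrier[OF one_carrier_mat VV] v1])
    have ABpsi: "(A x \<otimes>\<^sub>k B y) *\<^sub>v \<psi> \<in> carrier_vec (2 * 2)"
      by (rule mult_mat_vec_carrier[OF kron_carrier psi(1)]) (intro observableD(1) target_A target_B)+
    show "reorder e fA fB *\<^sub>v (\<xi> \<otimes>\<^sub>v ((A x \<otimes>\<^sub>k B y) *\<^sub>v \<psi>)) \<in> carrier_vec (e * ((fA * 2) * (fB * 2)))"
      by (rule carrier_vecI) (simp add: reorder_def swap_mat_def)
    fix k i j assume kij: "k < e" "i < fA" "j < fB"
    have "slice ((fA * 2) * (fB * 2)) ?lhs k =
      (VA \<otimes>\<^sub>k VB) *\<^sub>v ((JA \<otimes>\<^sub>k JB) *\<^sub>v ((At x \<otimes>\<^sub>k Bt y) *\<^sub>v slice (dA * dB) \<Psi> k))"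
      unfolding lhs slice_kron_one[OF VV v1 kij(1)] slice_kron_one[OF JJ v2 kij(1)] slice_kron_one[OF AB P(1) kij(1)] ..
    also have "(JA \<otimes>\<^sub>k JB) *\<^sub>v ((At x \<otimes>\<^sub>k Bt y) *\<^sub>v slice (dA * dB) \<Psi> k) =
      ((JA * At x) \<otimes>\<^sub>k (JB * Bt y)) *\<^sub>v slice (dA * dB) \<Psi> k"
      by (rule kron_mult_vec_vec[OF ja(1) jb(1) observableD(1)[OF At] observableD(1)[OF Bt] slice_carrier])
    \<comment> \<open>The Jordan identification moves the observables behind the embedding, where
      they act block by block.\<close>
    also have "\<dots> = ((block_sum fA (NA x) * JA) \<otimes>\<^sub>k (block_sum fB (NB y) * JB)) *\<^sub>v slice (dA * dB) \<Psi> k"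
      unfolding ja(4) jb(4) ..
    also have "\<dots> = (block_sum fA (NA x) \<otimes>\<^sub>k block_sum fB (NB y)) *\<^sub>v \<Phi> k"
      unfolding \<Phi>_def by (rule kron_mult_vec_vec[OF bna bnb ja(1) jb(1) slice_carrier, symmetric])
    finally have sl: "slice ((fA * 2) * (fB * 2)) ?lhs k =
      (VA \<otimes>\<^sub>k VB) *\<^sub>v ((block_sum fA (NA x) \<otimes>\<^sub>k block_sum fB (NB y)) *\<^sub>v \<Phi> k)" .
    have w: "(block_sum fA (NA x) \<otimes>\<^sub>k block_sum fB (NB y)) *\<^sub>v \<Phi> k \<in> carrier_vec ((fA * 2) * (fB * 2))"
      by (rule mult_mat_vec_carrier[OF kron_carrier[OF bna bnb] Phi])
    have "qubit_block fB (slice ((fA * 2) * (fB * 2)) ?lhs k) i j =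
      (rotation A (\<lambda>x. NA x i) \<otimes>\<^sub>k rotation B (\<lambda>y. NB y j)) *\<^sub>v
      qubit_block fB ((block_sum fA (NA x) \<otimes>\<^sub>k block_sum fB (NB y)) *\<^sub>v \<Phi> k) i j"
      unfolding sl unfolding VA_def VB_def by (rule qubit_block_mult[OF rA rB w kij(2,3)])
    also have "qubit_block fB ((block_sum fA (NA x) \<otimes>\<^sub>k block_sum fB (NB y)) *\<^sub>v \<Phi> k) i j =
      (NA x i \<otimes>\<^sub>k NB y j) *\<^sub>v \<phi> k i j"
      unfolding \<phi>_def by (rule qubit_block_mult[OF na nb Phi kij(2,3)])
    also have "(rotation A (\<lambda>x. NA x i) \<otimes>\<^sub>k rotation B (\<lambda>y. NB y j)) *\<^sub>v
      ((NA x i \<otimes>\<^sub>k NB y j) *\<^sub>v \<phi> k i j) = c k i j \<cdot>\<^sub>v ((A x \<otimes>\<^sub>k B y) *\<^sub>v \<psi>)" by (rule rot[OF kij])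
    also have "\<dots> = qubit_block fB (slice ((fA * 2) * (fB * 2))
        (reorder e fA fB *\<^sub>v (\<xi> \<otimes>\<^sub>v ((A x \<otimes>\<^sub>k B y) *\<^sub>v \<psi>))) k) i j"
      unfolding reorder_qubit_block[OF xi ABpsi kij] xi_index[OF kij] ..
    finally show "qubit_block fB (slice ((fA * 2) * (fB * 2)) ?lhs k) i j = qubit_block fB
      (slice ((fA * 2) * (fB * 2)) (reorder e fA fB *\<^sub>v (\<xi> \<otimes>\<^sub>v ((A x \<otimes>\<^sub>k B y) *\<^sub>v \<psi>))) k) i j" .
  qed
  with pure show ?thesis by blast
qed

end

text \<open>The first two conjuncts are Jordan's lemma for either party and keep the third from
  being vacuous. \<open>VA\<close> and \<open>VB\<close> act on the enlarged spaces, hence after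
  \<open>JA\<close> and \<open>JB\<close>, and are chosen before \<open>e\<close> and
  \<open>\<Psi>\<close> because one pair has to serve all purifications.\<close>

theorem lemma4:
  fixes b :: bell and \<eta> :: real
    and \<psi> :: "complex vec" and A B :: "bool \<Rightarrow> complex mat"
    and dA dB :: nat and \<rho> :: "complex mat" and At Bt :: "bool \<Rightarrow> complex mat"
  assumes bound: "is_quantum_bound b \<eta>"
    and target_state: "pure_state (2 * 2) \<psi>"
    and target_A: "\<And>x. observable 2 (A x)"
    and target_B: "\<And>y. observable 2 (B y)"
    and two_qubit: "\<And>\<rho>q Aq Bq. strategy 2 2 \<rho>q Aq Bq \<Longrightarrow> bell_value b 2 2 \<rho>q Aq Bq = \<eta> \<Longrightarrow>
      \<exists>UA UB. is_unitary 2 UA \<and> is_unitary 2 UB \<and>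
        (UA \<otimes>\<^sub>k UB) * \<rho>q * (mat_adjoint UA \<otimes>\<^sub>k mat_adjoint UB) = proj \<psi> \<and>
        (\<forall>x. UA * Aq x * mat_adjoint UA = A x) \<and>
        (\<forall>y. UB * Bq y * mat_adjoint UB = B y)"
    and strat: "strategy dA dB \<rho> At Bt"
    and optimal: "bell_value b dA dB \<rho> At Bt = \<eta>"
  shows "(\<exists>fA JA NA. jordan_identification dA At fA JA NA) \<and>
    (\<exists>fB JB NB. jordan_identification dB Bt fB JB NB) \<and>
    (\<forall>fA JA NA fB JB NB.
      jordan_identification dA At fA JA NA \<longrightarrow> jordan_identification dB Bt fB JB NB \<longrightarrow>
      (\<exists>VA VB. is_unitary (fA * 2) VA \<and> is_unitary (fB * 2) VB \<and>
        (\<forall>e \<Psi>. purification e (dA * dB) \<rho> \<Psi> \<longrightarrow>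
          (\<exists>\<xi>. pure_state (e * fA * fB) \<xi> \<and>
            (\<forall>x y.
              (1\<^sub>m e \<otimes>\<^sub>k VA \<otimes>\<^sub>k VB) *\<^sub>v ((1\<^sub>m e \<otimes>\<^sub>k JA \<otimes>\<^sub>k JB) *\<^sub>v
                ((1\<^sub>m e \<otimes>\<^sub>k At x \<otimes>\<^sub>k Bt y) *\<^sub>v \<Psi>)) =
              reorder e fA fB *\<^sub>v (\<xi> \<otimes>\<^sub>v ((A x \<otimes>\<^sub>k B y) *\<^sub>v \<psi>)))))))"
proof -
  interpret qubit_self_test b \<eta> \<psi> A B
    using bound target_state target_A target_B two_qubit by unfold_locales blast+
  have At: "observable dA (At x)" and Bt: "observable dB (Bt y)" for x y
    using strat by (auto simp: strategy_def)
  have unitary: "is_unitary (f * 2) (block_sum f (\<lambda>i. rotation T (\<lambda>x. N x i)))" for f T N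
    by (intro block_sum_unitary rotation_unitary)
  show ?thesis
    using jordan_identification_exists[of dA At, OF At] jordan_identification_exists[of dB Bt, OF Bt]
      unitary self_test[OF strat optimal] by blast
qed

end
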